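(* Suppose $\mathbf{Y}\sim SE_k(\boldsymbol{\mu},\mathbf{\Omega},\boldsymbol{\delta},g^{(k+1)})$ and the first four moments of $\mathbf{Y}$ exist. Then the Mardia measure of kurtosis of $\mathbf{Y}$ is $$\beta_{2,k}=\frac{3d+6a(ab-2c)\delta_{\ast}^2+a(4c-3a^3)\delta_{\ast}^4}{(b-a^2\delta_{\ast}^2)^2}+\frac{(k^2-1)d}{b^2}+\frac{2(k-1)[d+a(ab-2c)\delta_{\ast}^2]}{b(b-a^2\delta_{\ast}^2)},$$ where $\delta_{\ast}=\boldsymbol{\delta}^{\top}\mathbf{\Omega}^{-1}\boldsymbol{\delta}$, $a=\frac{\mathrm{E}[R]}{\mathrm{E}[R_0]}\sqrt{\frac{2}{\pi}}$, $b=\frac{\mathrm{E}[R^2]}{\mathrm{E}[R_0^2]}$, $c=\frac{\mathrm{E}[R^3]}{\mathrm{E}[R_0^3]}\sqrt{\frac{2}{\pi}}$ and $d=\frac{\mathrm{E}[R^4]}{\mathrm{E}[R_0^4]}$.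
   Context: Skew-elliptical distribution: let $\boldsymbol{\mu}\in\mathbb{R}^k$, let $\mathbf{\Omega}$ be a $k\times k$ symmetric positive definite matrix, let $\boldsymbol{\delta}\in\mathbb{R}^k$ with $\boldsymbol{\delta}^{\top}\mathbf{\Omega}^{-1}\boldsymbol{\delta}<1$, and let $g^{(k+1)}$ be a spherical $(k+1)$-dimensional density generator, i.e. a nonnegative function on $[0,\infty)$ such that $\boldsymbol{x}\mapsto g^{(k+1)}(\boldsymbol{x}^{\top}\boldsymbol{x})$ is a probability density on $\mathbb{R}^{k+1}$. One writes $\mathbf{Y}\sim SE_k(\boldsymbol{\mu},\mathbf{\Omega},\boldsymbol{\delta},g^{(k+1)})$ if the random vector $\mathbf{Y}$ in $\mathbb{R}^k$ has density $$f_{\mathbf{Y}}(\boldsymbol{y})=2|\mathbf{\Omega}|^{-1/2}\int_{-\infty}^{\boldsymbol{\alpha}^{\top}(\boldsymbol{y}-\boldsymbol{\mu})}g^{(k+1)}\left(r^2+(\boldsymbol{y}-\boldsymbol{\mu})^{\top}\mathbf{\Omega}^{-1}(\boldsymbol{y}-\boldsymbol{\mu})\right)\mathrm{d}r,\quad \boldsymbol{y}\in\mathbb{R}^k,\qquad \boldsymbol{\alpha}^{\top}=\frac{\boldsymbol{\delta}^{\top}\mathbf{\Omega}^{-1}}{(1-\boldsymbol{\delta}^{\top}\mathbf{\Omega}^{-1}\boldsymbol{\delta})^{1/2}}.$$ $R$ is a nonnegative random variable with density $h(r)=\frac{2\pi^{(k+1)/2}r^k g^{(k+1)}(r^2)}{\Gamma((k+1)/2)}$,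 $r>0$. $R_0\sim\chi_{k+1}$ (i.e. $R_0\ge 0$ and $R_0^2$ is chi-square with $k+1$ degrees of freedom), so $\mathrm{E}[R_0]=\frac{\sqrt{2}\,\Gamma(k/2+1)}{\Gamma((k+1)/2)}$, $\mathrm{E}[R_0^2]=k+1$, $\mathrm{E}[R_0^3]=\frac{2\sqrt{2}\,\Gamma(k/2+2)}{\Gamma((k+1)/2)}$, $\mathrm{E}[R_0^4]=(k+1)(k+3)$. Mardia measure of kurtosis: for a $k$-dimensional random vector $\mathbf{Y}$ with mean vector $\boldsymbol{\xi}$ and covariance matrix $\mathbf{\Delta}$, $\beta_{2,k}=\mathrm{E}\left[\left\{(\mathbf{Y}-\boldsymbol{\xi})^{\top}\mathbf{\Delta}^{-1}(\mathbf{Y}-\boldsymbol{\xi})\right\}^2\right]$.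
   Formalization: The formal theorem takes δ_* = (δᵀΩ⁻¹δ)^{1/2} instead of δᵀΩ⁻¹δ; with the latter the formula fails for the univariate skew-normal law (k = 1, Ω = 1, Gaussian generator, 0 < |δ| < 1). *)

theory Defs
  imports "HOL-Probability.Probability"
begin

definition positive_definite :: "real ^ 'n ^ 'n \<Rightarrow> bool" where
  "positive_definite A \<longleftrightarrow> (\<forall>x. x \<noteq> 0 \<longrightarrow> 0 < x \<bullet> (A *v x))"

definition spherical_density_generator :: "'v::euclidean_space itself \<Rightarrow> (real \<Rightarrow> real) \<Rightarrow> bool" where
  "spherical_density_generator _ g \<longleftrightarrow>
     (\<forall>t\<ge>0. 0 \<le> g t) \<and>
     (\<lambda>x::'v. g (x \<bullet> x)) \<in> borel_measurable borel \<and>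
     (\<integral>\<^sup>+x. ennreal (g ((x::'v) \<bullet> x)) \<partial>lborel) = 1"

text \<open>
  With \<open>k = CARD('n)\<close>, the space \<open>\<real>\<^bsup>k+1\<^esup>\<close> is rendered as the Euclidean space \<^typ>\<open>(real ^ 'n) \<times> real\<close>.
\<close>

lemma DIM_vec_times_real: "DIM((real ^ 'n) \<times> real) = CARD('n) + 1"
  by simp

definition skew_elliptical_alpha :: "real ^ 'n ^ 'n \<Rightarrow> real ^ 'n \<Rightarrow> real ^ 'n" where
  "skew_elliptical_alpha \<Omega> \<delta> =
     (1 / sqrt (1 - \<delta> \<bullet> (matrix_inv \<Omega> *v \<delta>))) *\<^sub>R (\<delta> v* matrix_inv \<Omega>)"

text \<open>
  The inner integral is a nonnegative (possibly infinite) Lebesgue integral, since the density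
  generator need not make it finite at every single \<open>y\<close>.
\<close>

definition skew_elliptical_density ::
    "real ^ 'n \<Rightarrow> real ^ 'n ^ 'n \<Rightarrow> real ^ 'n \<Rightarrow> (real \<Rightarrow> real) \<Rightarrow> real ^ 'n \<Rightarrow> ennreal" where
  "skew_elliptical_density \<mu> \<Omega> \<delta> g y =
     ennreal (2 * det \<Omega> powr (- 1 / 2)) *
     (\<integral>\<^sup>+r\<in>{..skew_elliptical_alpha \<Omega> \<delta> \<bullet> (y - \<mu>)}.
        ennreal (g (r\<^sup>2 + (y - \<mu>) \<bullet> (matrix_inv \<Omega> *v (y - \<mu>)))) \<partial>lborel)"

definition skew_elliptical ::
    "'a measure \<Rightarrow> ('a \<Rightarrow> real ^ 'n) \<Rightarrow>
     real ^ 'n \<Rightarrow> real ^ 'n ^ 'n \<Rightarrow> real ^ 'n \<Rightarrow> (real \<Rightarrow> real) \<Rightarrow> bool" where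
  "skew_elliptical M Y \<mu> \<Omega> \<delta> g \<longleftrightarrow>
     transpose \<Omega> = \<Omega> \<and> positive_definite \<Omega> \<and>
     \<delta> \<bullet> (matrix_inv \<Omega> *v \<delta>) < 1 \<and>
     spherical_density_generator TYPE((real ^ 'n) \<times> real) g \<and>
     distributed M lborel Y (skew_elliptical_density \<mu> \<Omega> \<delta> g)"

definition radial_density :: "nat \<Rightarrow> (real \<Rightarrow> real) \<Rightarrow> real \<Rightarrow> real" where
  "radial_density k g r =
     (if 0 < r
      then 2 * pi powr ((real k + 1) / 2) * r ^ k * g (r\<^sup>2) / Gamma ((real k + 1) / 2)
      else 0)"

definition chi_square_density :: "nat \<Rightarrow> real \<Rightarrow> real" where
  "chi_square_density n x =
     (if 0 < x
      then x powr (real n / 2 - 1) * exp (- x / 2) / (2 powr (real n / 2) * Gamma (real n / 2))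
      else 0)"

definition chi_distributed :: "'a measure \<Rightarrow> ('a \<Rightarrow> real) \<Rightarrow> nat \<Rightarrow> bool" where
  "chi_distributed M X n \<longleftrightarrow>
     X \<in> borel_measurable M \<and> (AE \<omega> in M. 0 \<le> X \<omega>) \<and>
     distributed M lborel (\<lambda>\<omega>. (X \<omega>)\<^sup>2) (\<lambda>x. ennreal (chi_square_density n x))"

text \<open>
  Moments of a random vector up to order \<open>m\<close>: all products of at most \<open>m\<close> components, where a list
  of indices (with repetitions allowed) selects the factors.
\<close>

definition moments_exist :: "'a measure \<Rightarrow> ('a \<Rightarrow> real ^ 'n) \<Rightarrow> nat \<Rightarrow> bool" where
  "moments_exist M Y m \<longleftrightarrow>
     (\<forall>is::'n list. length is \<le> m \<longrightarrow> integrable M (\<lambda>\<omega>. \<Prod>i\<leftarrow>is. Y \<omega> $ i))"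

definition mean_vector :: "'a measure \<Rightarrow> ('a \<Rightarrow> real ^ 'n) \<Rightarrow> real ^ 'n" where
  "mean_vector M Y = (\<chi> i. \<integral>\<omega>. Y \<omega> $ i \<partial>M)"

definition covariance_matrix :: "'a measure \<Rightarrow> ('a \<Rightarrow> real ^ 'n) \<Rightarrow> real ^ 'n ^ 'n" where
  "covariance_matrix M Y =
     (\<chi> i j. \<integral>\<omega>. (Y \<omega> $ i - mean_vector M Y $ i) * (Y \<omega> $ j - mean_vector M Y $ j) \<partial>M)"

definition mardia_kurtosis :: "'a measure \<Rightarrow> ('a \<Rightarrow> real ^ 'n) \<Rightarrow> real" where
  "mardia_kurtosis M Y =
     (\<integral>\<omega>. ((Y \<omega> - mean_vector M Y) \<bullet>
           (matrix_inv (covariance_matrix M Y) *v (Y \<omega> - mean_vector M Y)))\<^sup>2 \<partial>M)"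

text \<open>
  This is the square root of \<open>\<delta>\<^sup>T \<Omega>\<^sup>-\<^sup>1 \<delta>\<close>: in canonical form the single skewed component has variance
  \<open>b - a\<^sup>2 (\<delta>\<^sup>T \<Omega>\<^sup>-\<^sup>1 \<delta>)\<close>, so this is the quantity whose square has to occur in the kurtosis formula.
  Without the root the formula already fails for the univariate skew-normal distribution.
\<close>

definition delta_star :: "real ^ 'n ^ 'n \<Rightarrow> real ^ 'n \<Rightarrow> real" where
  "delta_star \<Omega> \<delta> = sqrt (\<delta> \<bullet> (matrix_inv \<Omega> *v \<delta>))"

end

theory Submission
  imports Defs "HOL-Real_Asymp.Real_Asymp"
begin

text \<open>
  Choose a matrix \<open>A\<close> with \<open>A\<^sup>T \<Omega>\<^sup>-\<^sup>1 A = 1\<close> that sends \<open>\<delta>\<^sub>* e\<^sub>1\<close> to \<open>\<delta>\<close> (\<open>canonical_factor\<close>), and put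
  \<open>V = A\<^sup>-\<^sup>1 (Y - \<mu>)\<close>. Then \<open>V\<close> is distributed as the \<open>u\<close> component of a random pair \<open>(u, r)\<close> in
  \<open>\<real>\<^bsup>k\<^esup> \<times> \<real>\<close> with density \<open>w(u, r) g(|u|\<^sup>2 + r\<^sup>2)\<close>, where \<open>w(u, r)\<close> is 2 if \<open>r \<le> l u\<^sub>1\<close> and 0 otherwise,
  and \<open>l = \<delta>\<^sub>* / sqrt (1 - \<delta>\<^sub>*\<^sup>2)\<close> (\<open>skew_elliptical_canonical_nn_integral\<close>). So only the first
  coordinate is skewed.

  The generator enters through radial moments alone. For a function \<open>q\<close> that is positively
  homogeneous of degree \<open>m\<close>, the push-forward of \<open>q(x) dx\<close> under \<open>x \<mapsto> x \<bullet> x\<close> is a multiple of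
  \<open>t\<^bsup>(N+m)/2-1\<^esup> dt\<close> (\<open>nn_integral_homogeneous_radial\<close>), so replacing the Gaussian generator by \<open>g\<close>
  multiplies the integral of \<open>q\<close> by a factor that depends only on \<open>m\<close>
  (\<open>homogeneous_gaussian_comparison\<close>). That factor is \<open>E R\<^sup>m / E R\<^sub>0\<^sup>m\<close> (\<open>moment_ratio\<close>). The weight
  \<open>w\<close> is homogeneous of degree 0, so each monomial moment of \<open>V\<close> is this ratio times the moment of
  a skew-normal vector. For a Gaussian generator the coordinates of \<open>V\<close> are independent: the first
  is skew-normal, the others are standard normal (\<open>gaussian_skew_monomial\<close>). Even moments of a
  skew-normal variable are those of a normal one, and its first and third moments are
  \<open>sqrt (2/\<pi>) \<delta>\<^sub>*\<close> and \<open>sqrt (2/\<pi>) \<delta>\<^sub>* (3 - \<delta>\<^sub>*\<^sup>2)\<close>.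

  Hence \<open>V\<close> has mean \<open>a \<delta>\<^sub>* e\<^sub>1\<close> and diagonal covariance, with entry \<open>b - a\<^sup>2 \<delta>\<^sub>*\<^sup>2\<close> in the first
  coordinate and \<open>b\<close> elsewhere. The entries are positive, because \<open>a\<close> and \<open>b\<close> are the first two
  absolute moments of one coordinate of a spherical vector, so that \<open>a\<^sup>2 \<le> b\<close>. Mardia's kurtosis is
  invariant under affine maps, hence equals the double sum of
  \<open>E[X\<^sub>i\<^sup>2 X\<^sub>j\<^sup>2] / (v\<^sub>i v\<^sub>j)\<close> over the centred coordinates \<open>X\<close> of \<open>V\<close>. It has one term for
  \<open>i = j = 1\<close>, \<open>2(k - 1)\<close> equal terms that involve the first coordinate once, and an unskewed block
  of total \<open>(k\<^sup>2 - 1) d / b\<^sup>2\<close>; these are the three summands of the formula.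

  All moments that occur are finite: the fourth moment of \<open>V\<^sub>1\<close>, which exists by hypothesis, is a
  positive multiple of the radial integral of \<open>g\<close> of index \<open>k + 1 + 4\<close>, and the integrals of lower
  index are bounded by the sum of that one and the one of index \<open>k + 1\<close>, which represents the total
  mass.
\<close>

section \<open>Radial integration of homogeneous functions\<close>

lemma nn_integral_scale_lborel:
  fixes f :: "'v::euclidean_space \<Rightarrow> ennreal"
  assumes [measurable]: "f \<in> borel_measurable borel" and s: "0 < s"
  shows "(\<integral>\<^sup>+x. f x \<partial>lborel) = ennreal (s ^ DIM('v)) * (\<integral>\<^sup>+x. f (s *\<^sub>R x) \<partial>lborel)"
proof -
  have "(\<integral>\<^sup>+x. f x \<partial>lborel) =
      (\<integral>\<^sup>+x. f x \<partial>density (distr lborel borel (\<lambda>x. 0 + s *\<^sub>R x)) (\<lambda>_. ennreal (\<bar>s\<bar> ^ DIM('v))))"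
    using lborel_affine[of s "0::'v"] s by simp
  also have "\<dots> = (\<integral>\<^sup>+x. ennreal (s ^ DIM('v)) * f (s *\<^sub>R x) \<partial>lborel)"
    using s by (simp add: nn_integral_density nn_integral_distr)
  also have "\<dots> = ennreal (s ^ DIM('v)) * (\<integral>\<^sup>+x. f (s *\<^sub>R x) \<partial>lborel)"
    by (simp add: nn_integral_cmult)
  finally show ?thesis .
qed

lemma nn_integral_powr_Ioc:
  assumes "0 < \<beta>" "0 \<le> t"
  shows "(\<integral>\<^sup>+s. ennreal (s powr (\<beta> - 1)) * indicator {0<..t} s \<partial>lborel) = ennreal (t powr \<beta> / \<beta>)"
proof -
  have "((\<lambda>s. s powr (\<beta> - 1)) has_integral (t powr (\<beta> - 1 + 1) / (\<beta> - 1 + 1))) {0..t}"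
    using assms by (intro has_integral_powr_from_0) auto
  then have "((\<lambda>s. if s \<in> {0..t} then s powr (\<beta> - 1) else 0) has_integral (t powr \<beta> / \<beta>)) UNIV"
    by (simp only: has_integral_restrict_UNIV) simp
  then have "(\<integral>\<^sup>+s. ennreal (if s \<in> {0..t} then s powr (\<beta> - 1) else 0) \<partial>lborel) = ennreal (t powr \<beta> / \<beta>)"
    by (intro nn_integral_has_integral_lborel) auto
  also have "(\<integral>\<^sup>+s. ennreal (if s \<in> {0..t} then s powr (\<beta> - 1) else 0) \<partial>lborel)
     = (\<integral>\<^sup>+s. ennreal (s powr (\<beta> - 1)) * indicator {0<..t} s \<partial>lborel)"
    by (intro nn_integral_cong) (auto simp: indicator_def)
  finally show ?thesis .
qed

text \<open>
  Up to a constant, \<open>radial_integral n f\<close> is the integral of \<open>f (x \<bullet> x)\<close> over \<open>\<real>\<^sup>n\<close>, written in the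
  variable \<open>t = x \<bullet> x\<close>. A homogeneous weight of degree \<open>m\<close> merely raises the index to \<open>n + m\<close>.
\<close>

definition radial_integral :: "nat \<Rightarrow> (real \<Rightarrow> ennreal) \<Rightarrow> ennreal" where
  "radial_integral n f = (\<integral>\<^sup>+t. ennreal (t powr (real n / 2 - 1)) * indicator {0<..} t * f t \<partial>lborel)"

lemma nn_integral_homogeneous_ball:
  fixes p :: "'v::euclidean_space \<Rightarrow> ennreal"
  assumes [measurable]: "p \<in> borel_measurable borel"
    and hom: "\<And>s x. 0 < s \<Longrightarrow> p (s *\<^sub>R x) = ennreal (s ^ m) * p x"
    and t: "0 < t"
  shows "(\<integral>\<^sup>+x. p x * indicator {x. x \<bullet> x \<le> t} x \<partial>lborel) =
    ennreal (t powr (real (DIM('v) + m) / 2)) * (\<integral>\<^sup>+x. p x * indicator {x. x \<bullet> x \<le> 1} x \<partial>lborel)"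
proof -
  \<comment> \<open>Substituting \<open>s x\<close> with \<open>s = sqrt t\<close> maps the unit ball to the ball of squared radius \<open>t\<close>.\<close>
  let ?s = "sqrt t"
  have s: "?s > 0" using t by simp
  have ind: "indicator {x. x \<bullet> x \<le> t} (?s *\<^sub>R x) = (indicator {x. x \<bullet> x \<le> 1} x :: ennreal)" for x :: 'v
  proof -
    have "(?s *\<^sub>R x) \<bullet> (?s *\<^sub>R x) = t * (x \<bullet> x)"
      using t by (simp add: mult.assoc[symmetric])
    then show ?thesis using t by (simp only: indicator_def mem_Collect_eq) simp
  qed
  have pw: "?s ^ DIM('v) * ?s ^ m = t powr (real (DIM('v) + m) / 2)"
  proof -
    have "?s ^ DIM('v) * ?s ^ m = (t powr (1/2)) ^ (DIM('v) + m)"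
      using t by (simp add: power_add powr_half_sqrt)
    also have "\<dots> = t powr (real (DIM('v) + m) / 2)"
      using t by (simp add: powr_powr powr_realpow[symmetric])
    finally show ?thesis .
  qed
  have "(\<integral>\<^sup>+x. p x * indicator {x. x \<bullet> x \<le> t} x \<partial>lborel) =
      ennreal (?s ^ DIM('v)) * (\<integral>\<^sup>+x. p (?s *\<^sub>R x) * indicator {x. x \<bullet> x \<le> t} (?s *\<^sub>R x) \<partial>lborel)"
    by (rule nn_integral_scale_lborel[OF _ s]) simp
  also have "\<dots> = ennreal (?s ^ DIM('v)) *
      (\<integral>\<^sup>+x. ennreal (?s ^ m) * (p x * indicator {x. x \<bullet> x \<le> 1} x) \<partial>lborel)"
    by (simp only: hom[OF s] ind mult.assoc)
  also have "\<dots> = ennreal (?s ^ DIM('v) * ?s ^ m) * (\<integral>\<^sup>+x. p x * indicator {x. x \<bullet> x \<le> 1} x \<partial>lborel)"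
    using s by (simp add: nn_integral_cmult mult.assoc ennreal_mult)
  finally show ?thesis by (simp only: pw)
qed

text \<open>
  Scaling shows that the \<open>p\<close>-mass of the ball of squared radius \<open>t\<close> is proportional to a power of
  \<open>t\<close>; this determines the push-forward of \<open>p(x) dx\<close> under \<open>x \<mapsto> x \<bullet> x\<close>, since the half-lines
  \<open>{..t}\<close> generate the Borel sets. This is integration in polar coordinates with the spherical part
  expressed through the \<open>p\<close>-mass of the unit ball.
\<close>

lemma nn_integral_homogeneous_radial:
  fixes p :: "'v::euclidean_space \<Rightarrow> ennreal"
  assumes [measurable]: "p \<in> borel_measurable borel"
    and hom: "\<And>s x. 0 < s \<Longrightarrow> p (s *\<^sub>R x) = ennreal (s ^ m) * p x"
    and fin: "(\<integral>\<^sup>+x. p x * indicator {x. x \<bullet> x \<le> 1} x \<partial>lborel) < \<infinity>"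
    and [measurable]: "f \<in> borel_measurable borel"
  shows "(\<integral>\<^sup>+x. p x * f (x \<bullet> x) \<partial>lborel) =
    ennreal (real (DIM('v) + m) / 2) * (\<integral>\<^sup>+x. p x * indicator {x. x \<bullet> x \<le> 1} x \<partial>lborel)
      * radial_integral (DIM('v) + m) f"
proof -
  let ?n = "DIM('v) + m"
  let ?\<beta> = "real ?n / 2"
  let ?C = "\<integral>\<^sup>+x. p x * indicator {x. x \<bullet> x \<le> 1} x \<partial>lborel"
  let ?K = "ennreal ?\<beta> * ?C"
  let ?w = "\<lambda>t. ?K * (ennreal (t powr (?\<beta> - 1)) * indicator {0<..} t)"
  have \<beta>: "0 < ?\<beta>" using DIM_positive[where 'a='v] by (simp del: DIM_positive)
  have eq: "distr (density lborel p) borel (\<lambda>x. x \<bullet> x) = density lborel ?w" (is "?\<nu> = ?\<rho>")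
  proof (rule measure_eqI_generator_eq[where E="range atMost" and \<Omega>=UNIV and A="\<lambda>i. {..real i}"])
    show "Int_stable (range (atMost :: real \<Rightarrow> _))"
      by (auto simp: Int_stable_def)
    have \<nu>: "emeasure ?\<nu> {..t} = (\<integral>\<^sup>+x. p x * indicator {x. x \<bullet> x \<le> t} x \<partial>lborel)" for t
      by (subst emeasure_distr) (auto simp: emeasure_density vimage_def)
    have \<rho>: "emeasure ?\<rho> {..t} = ?K * ennreal (t powr ?\<beta> / ?\<beta>)" if "0 \<le> t" for t
    proof -
      have "emeasure ?\<rho> {..t} =
          (\<integral>\<^sup>+s. ?K * (ennreal (s powr (?\<beta> - 1)) * indicator {0<..t} s) \<partial>lborel)"
        by (simp add: emeasure_density mult.assoc)
           (intro nn_integral_cong, auto simp: indicator_def)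
      also have "\<dots> = ?K * ennreal (t powr ?\<beta> / ?\<beta>)"
        using that \<beta> by (subst nn_integral_cmult) (auto simp: nn_integral_powr_Ioc)
      finally show ?thesis .
    qed
    show "emeasure ?\<nu> X = emeasure ?\<rho> X" if X: "X \<in> range atMost" for X
    proof -
      obtain t where X: "X = {..t}" using X by auto
      consider "t < 0" | "t = 0" | "0 < t" by linarith
      then show ?thesis
      proof cases
        case 1
        then have "{x::'v. x \<bullet> x \<le> t} = {}"
          by (auto simp: not_le intro: order_less_le_trans)
        moreover have "emeasure ?\<rho> {..t} = (\<integral>\<^sup>+s. 0 \<partial>lborel)"
          using 1 by (auto simp: emeasure_density nn_integral_0_iff_AE indicator_def)
        ultimately show ?thesis by (simp add: X \<nu>)
      next
        case 2
        have "AE x in lborel. p x * indicator {x. x \<bullet> x \<le> t} x = 0"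
          using AE_lborel_singleton[of "0::'v"] 2
          by (auto simp: indicator_def dest!: order_antisym[OF _ inner_ge_zero])
        then have "(\<integral>\<^sup>+x. p x * indicator {x. x \<bullet> x \<le> t} x \<partial>lborel) = 0"
          by (subst nn_integral_0_iff_AE) auto
        then show ?thesis using 2 \<rho>[of 0] by (simp add: X \<nu>)
      next
        case 3
        have "ennreal (t powr ?\<beta>) * ?C = ?K * ennreal (t powr ?\<beta> / ?\<beta>)"
        proof -
          have "?K * ennreal (t powr ?\<beta> / ?\<beta>) = ennreal (?\<beta> * (t powr ?\<beta> / ?\<beta>)) * ?C"
            using \<beta> by (subst ennreal_mult) (auto simp: ac_simps)
          also have "?\<beta> * (t powr ?\<beta> / ?\<beta>) = t powr ?\<beta>" using \<beta> by simp
          finally show ?thesis by simp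
        qed
        then show ?thesis
          using nn_integral_homogeneous_ball[OF assms(1) hom 3] \<rho>[of t] 3 by (simp add: X \<nu>)
      qed
    qed
    show "sets ?\<nu> = sigma_sets UNIV (range atMost)" "sets ?\<rho> = sigma_sets UNIV (range atMost)"
      using arg_cong[OF borel_eq_atMost[where 'a=real], of sets] by simp_all
    show "emeasure ?\<nu> {..real i} \<noteq> \<infinity>" for i
    proof (cases "i = 0")
      case True
      have "emeasure ?\<nu> {..real i} \<le> ?C"
        unfolding \<nu> using True by (intro nn_integral_mono) (auto simp: indicator_def)
      then show ?thesis using fin by (auto simp: top_unique)
    next
      case False
      then show ?thesis
        unfolding \<nu> using nn_integral_homogeneous_ball[OF assms(1) hom, of "real i"] fin
        by (simp add: ennreal_mult_eq_top_iff)
    qed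
  qed (auto, metis UNIV_I UN_I atMost_iff real_arch_simple)
  have "(\<integral>\<^sup>+x. p x * f (x \<bullet> x) \<partial>lborel) = (\<integral>\<^sup>+t. f t \<partial>?\<nu>)"
    by (simp add: nn_integral_distr nn_integral_density)
  also have "\<dots> = (\<integral>\<^sup>+t. ?K * (ennreal (t powr (?\<beta> - 1)) * indicator {0<..} t * f t) \<partial>lborel)"
    unfolding eq by (subst nn_integral_density) (auto simp: mult.assoc)
  also have "\<dots> = ?K * radial_integral ?n f"
    unfolding radial_integral_def by (subst nn_integral_cmult) auto
  finally show ?thesis .
qed

section \<open>One-dimensional skew-normal moments\<close>

text \<open>
  A Bochner integral rather than a measure of a half-line, so that Fubini's theorem applies directly.
\<close>

definition std_normal_cdf :: "real \<Rightarrow> real" where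
  "std_normal_cdf y = (\<integral>r. std_normal_density r * indicator {..y} r \<partial>lborel)"

lemma integrable_std_normal_indicator:
  "A \<in> sets borel \<Longrightarrow> integrable lborel (\<lambda>r. std_normal_density r * indicator A r)"
  using integrable_mult_indicator[of A lborel std_normal_density]
  by (simp add: mult.commute)

lemma std_normal_cdf_measurable [measurable]: "std_normal_cdf \<in> borel_measurable borel"
proof -
  have "(\<lambda>y. \<integral>r. std_normal_density r * (if r \<le> y then 1 else 0) \<partial>lborel) \<in> borel_measurable borel"
    by measurable
  also have "(\<lambda>y. \<integral>r. std_normal_density r * (if r \<le> y then 1 else 0) \<partial>lborel) = std_normal_cdf"
    unfolding std_normal_cdf_def by (intro ext Bochner_Integration.integral_cong) (auto simp: indicator_def)
  finally show ?thesis .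
qed

lemma std_normal_cdf_nonneg: "0 \<le> std_normal_cdf y"
  unfolding std_normal_cdf_def by (intro integral_nonneg_AE) auto

text \<open>
  This symmetry is the reason why skewing leaves the even moments unchanged.
\<close>

lemma std_normal_cdf_minus: "std_normal_cdf (- y) = 1 - std_normal_cdf y"
proof -
  have "std_normal_cdf (- y) = (\<integral>r. std_normal_density (- r) * indicator {..- y} (- r) \<partial>lborel)"
    unfolding std_normal_cdf_def
    using lborel_integral_real_affine[of "-1" "\<lambda>r. std_normal_density r * indicator {..- y} r" 0] by simp
  also have "\<dots> = (\<integral>r. std_normal_density r * indicator {y..} r \<partial>lborel)"
    by (intro Bochner_Integration.integral_cong) (auto simp: indicator_def std_normal_density_def)
  finally have "std_normal_cdf (- y) + std_normal_cdf y =
      (\<integral>r. std_normal_density r * indicator {y..} r + std_normal_density r * indicator {..y} r \<partial>lborel)"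
    unfolding std_normal_cdf_def[of y]
    by (subst Bochner_Integration.integral_add) (auto intro!: integrable_std_normal_indicator)
  also have "\<dots> = (\<integral>r. std_normal_density r \<partial>lborel)"
    using AE_lborel_singleton[of y]
    by (intro integral_cong_AE) (auto simp: indicator_def)
  finally show ?thesis by simp
qed

lemma std_normal_cdf_le_1: "std_normal_cdf y \<le> 1"
  using std_normal_cdf_minus[of y] std_normal_cdf_nonneg[of "- y"] by simp

lemma integrable_std_normal_power_cdf:
  "integrable lborel (\<lambda>x. std_normal_density x * (2 * std_normal_cdf (l * x)) * x ^ j)"
proof (rule Bochner_Integration.integrable_bound)
  show "integrable lborel (\<lambda>x. 2 * (std_normal_density x * x ^ j))"
    by (intro integrable_mult_right integrable_std_normal_moment)
  show "AE x in lborel. norm (std_normal_density x * (2 * std_normal_cdf (l * x)) * x ^ j)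
      \<le> norm (2 * (std_normal_density x * x ^ j))"
    using std_normal_cdf_le_1 std_normal_cdf_nonneg
    by (auto simp: abs_mult mult_left_le mult_left_le_one_le intro!: AE_I2 mult_left_mono mult_right_mono)
qed auto

text \<open>
  The factor \<open>2 \<Phi>(l x)\<close> turns the standard normal density into the skew-normal density with slant
  \<open>l\<close>; the slant 0 gives back the normal density, so one definition serves skewed and unskewed coordinates.
\<close>

definition skew_normal_moment :: "real \<Rightarrow> nat \<Rightarrow> real" where
  "skew_normal_moment l j = (\<integral>x. std_normal_density x * (2 * std_normal_cdf (l * x)) * x ^ j \<partial>lborel)"

lemma skew_normal_moment_even:
  assumes "even j"
  shows "skew_normal_moment l j = (\<integral>x. std_normal_density x * x ^ j \<partial>lborel)"
proof -
  have "skew_normal_moment l j =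
     (\<integral>x. std_normal_density (- x) * (2 * std_normal_cdf (l * - x)) * (- x) ^ j \<partial>lborel)"
    unfolding skew_normal_moment_def
    using lborel_integral_real_affine[of "-1"
        "\<lambda>x. std_normal_density x * (2 * std_normal_cdf (l * x)) * x ^ j" 0]
    by simp
  also have "\<dots> = (\<integral>x. std_normal_density x * (2 * std_normal_cdf (- (l * x))) * x ^ j \<partial>lborel)"
    using assms by (intro Bochner_Integration.integral_cong) (auto simp: std_normal_density_def)
  also have "\<dots> = (\<integral>x. 2 * (std_normal_density x * x ^ j)
      - std_normal_density x * (2 * std_normal_cdf (l * x)) * x ^ j \<partial>lborel)"
    by (intro Bochner_Integration.integral_cong) (auto simp: std_normal_cdf_minus algebra_simps)
  also have "\<dots> = 2 * (\<integral>x. std_normal_density x * x ^ j \<partial>lborel) - skew_normal_moment l j"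
    unfolding skew_normal_moment_def
    by (subst Bochner_Integration.integral_diff)
       (auto intro!: integrable_mult_right integrable_std_normal_moment integrable_std_normal_power_cdf)
  finally show ?thesis by simp
qed

text \<open>
  The integrand may change sign, so monotone convergence does not give this; integrability on the line
  replaces it.
\<close>

lemma integral_tail_FTC:
  fixes f F :: "real \<Rightarrow> real"
  assumes F: "\<And>x. (F has_real_derivative f x) (at x)"
    and f: "\<And>x. isCont f x" and int: "integrable lborel f"
    and lim: "(F \<longlongrightarrow> 0) at_top"
  shows "(\<integral>x. f x * indicator {s..} x \<partial>lborel) = - F s"
proof -
  have "(LBINT x=ereal s..\<infinity>. f x) = 0 - F s"
  proof (rule interval_integral_FTC_integrable)
    show "(F has_vector_derivative f x) (at x)" for x
      using F by (simp add: has_real_derivative_iff_has_vector_derivative)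
    show "set_integrable lborel (einterval (ereal s) \<infinity>) f"
      using int unfolding set_integrable_def by (intro integrable_mult_indicator) auto
    show "((F \<circ> real_of_ereal) \<longlongrightarrow> F s) (at_right (ereal s))"
      using DERIV_isCont[OF F, of s]
      by (auto simp: ereal_tendsto_simps1 isCont_def intro: filterlim_mono at_le)
    show "((F \<circ> real_of_ereal) \<longlongrightarrow> 0) (at_left \<infinity>)"
      using lim by (simp add: ereal_tendsto_simps1)
  qed (use f in auto)
  also have "(LBINT x=ereal s..\<infinity>. f x) = (\<integral>x. f x * indicator {s..} x \<partial>lborel)"
    unfolding interval_lebesgue_integral_def set_lebesgue_integral_def
    using AE_lborel_singleton[of s] int
    by (auto intro!: integral_cong_AE simp: indicator_def)
  finally show ?thesis by simp
qed

lemma std_normal_density_DERIV: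
  "(std_normal_density has_real_derivative - x * std_normal_density x) (at x)"
proof -
  have "((\<lambda>x. c * exp (- x\<^sup>2 / 2)) has_real_derivative - x * (c * exp (- x\<^sup>2 / 2))) (at x)" for c :: real
    by (auto intro!: derivative_eq_intros)
  then show ?thesis unfolding std_normal_density_def .
qed

lemma std_normal_tail_1:
  "(\<integral>x. std_normal_density x * x ^ 1 * indicator {s..} x \<partial>lborel) = std_normal_density s"
proof -
  have "(\<integral>x. (std_normal_density x * x ^ 1) * indicator {s..} x \<partial>lborel) = - (- std_normal_density s)"
  proof (rule integral_tail_FTC)
    show "((\<lambda>x. - std_normal_density x) has_real_derivative std_normal_density x * x ^ 1) (at x)" for x
      by (auto intro!: derivative_eq_intros std_normal_density_DERIV)
    show "((\<lambda>x. - std_normal_density x) \<longlongrightarrow> 0) at_top"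
      unfolding std_normal_density_def by real_asymp
    show "isCont (\<lambda>x. std_normal_density x * x ^ 1) x" for x
      unfolding std_normal_density_def by (auto intro!: continuous_intros)
  qed (rule integrable_std_normal_moment)
  then show ?thesis by simp
qed

lemma std_normal_tail_3:
  "(\<integral>x. std_normal_density x * x ^ 3 * indicator {s..} x \<partial>lborel) = std_normal_density s * (s\<^sup>2 + 2)"
proof -
  have "(\<integral>x. (std_normal_density x * x ^ 3) * indicator {s..} x \<partial>lborel)
      = - (- (std_normal_density s * (s\<^sup>2 + 2)))"
  proof (rule integral_tail_FTC)
    show "((\<lambda>x. - (std_normal_density x * (x\<^sup>2 + 2))) has_real_derivative std_normal_density x * x ^ 3) (at x)" for x
      by (auto intro!: derivative_eq_intros std_normal_density_DERIV
          simp: power2_eq_square power3_eq_cube algebra_simps)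
    show "((\<lambda>x. - (std_normal_density x * (x\<^sup>2 + 2))) \<longlongrightarrow> 0) at_top"
      unfolding std_normal_density_def by real_asymp
    show "isCont (\<lambda>x. std_normal_density x * x ^ 3) x" for x
      unfolding std_normal_density_def by (auto intro!: continuous_intros)
  qed (rule integrable_std_normal_moment)
  then show ?thesis by simp
qed

text \<open>
  For odd \<open>j\<close> the truncated moments of the normal density are elementary, unlike \<open>\<Phi>\<close>. Exchanging
  the order of integration therefore reduces the odd moments to integrals of a Gaussian product.
\<close>

lemma skew_normal_moment_swap:
  assumes l: "0 < l"
  shows "skew_normal_moment l j =
    (\<integral>r. 2 * std_normal_density r *
      (\<integral>x. std_normal_density x * x ^ j * indicator {r / l..} x \<partial>lborel) \<partial>lborel)"
proof -
  let ?f = "\<lambda>x r. 2 * std_normal_density r * (std_normal_density x * x ^ j * indicator {r / l..} x)"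
  have meas: "case_prod ?f \<in> borel_measurable (lborel \<Otimes>\<^sub>M lborel)"
  proof -
    have "(\<lambda>z::real\<times>real. 2 * std_normal_density (snd z) *
        (std_normal_density (fst z) * fst z ^ j * (if snd z / l \<le> fst z then 1 else 0)))
      \<in> borel_measurable (borel \<Otimes>\<^sub>M borel)" by measurable
    then show ?thesis
      by (simp add: case_prod_beta indicator_def of_bool_def)
  qed
  have ind: "indicator {r / l..} x = (indicator {..l * x} r :: real)" for x r
    using l by (auto simp: indicator_def field_simps)
  have inner: "?f x = (\<lambda>r. 2 * std_normal_density x * x ^ j * (std_normal_density r * indicator {..l * x} r))" for x
    by (simp add: fun_eq_iff ind)
  have int_f: "integrable lborel (?f x)" for x
    unfolding inner by (intro integrable_mult_right integrable_std_normal_indicator) auto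
  have "integrable (lborel \<Otimes>\<^sub>M lborel) (case_prod ?f)"
  proof (rule lborel_pair.Fubini_integrable[OF meas])
    have "(\<integral>r. norm (?f x r) \<partial>lborel) = norm (std_normal_density x * (2 * std_normal_cdf (l * x)) * x ^ j)" for x
    proof -
      have "(\<integral>r. norm (?f x r) \<partial>lborel) =
        (\<integral>r. 2 * std_normal_density x * \<bar>x\<bar> ^ j * (std_normal_density r * indicator {..l * x} r) \<partial>lborel)"
        by (intro Bochner_Integration.integral_cong) (auto simp: ind abs_mult power_abs)
      also have "\<dots> = 2 * std_normal_density x * \<bar>x\<bar> ^ j * std_normal_cdf (l * x)"
        unfolding std_normal_cdf_def by simp
      finally show ?thesis by (simp add: abs_mult power_abs std_normal_cdf_nonneg)
    qed
    then show "integrable lborel (\<lambda>x. \<integral>r. norm (case_prod ?f (x, r)) \<partial>lborel)"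
      using integrable_norm[OF integrable_std_normal_power_cdf[of l j]] by simp
  qed (use int_f in auto)
  then have "(\<integral>r. (\<integral>x. ?f x r \<partial>lborel) \<partial>lborel) = (\<integral>x. (\<integral>r. ?f x r \<partial>lborel) \<partial>lborel)"
    by (rule lborel_pair.Fubini_integral)
  also have "\<dots> = skew_normal_moment l j"
    unfolding skew_normal_moment_def inner std_normal_cdf_def
    by (intro Bochner_Integration.integral_cong) (auto simp: mult.assoc)
  finally show ?thesis by simp
qed

text \<open>
  The precisions of the two factors add up to \<open>1 + 1/l\<^sup>2\<close>, whose inverse is \<open>s\<^sup>2\<close>.
\<close>

lemma std_normal_density_mult:
  assumes l: "0 < l"
  defines "s \<equiv> l / sqrt (1 + l\<^sup>2)"
  shows "2 * std_normal_density r * std_normal_density (r / l) = sqrt (2 / pi) * s * normal_density 0 s r"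
proof -
  have s: "0 < s" unfolding s_def using l by (auto intro!: divide_pos_pos real_sqrt_gt_zero add_pos_nonneg)
  have l2: "1 + l\<^sup>2 > 0" by (auto intro: add_pos_nonneg)
  have s2: "s\<^sup>2 = l\<^sup>2 / (1 + l\<^sup>2)"
    unfolding s_def using l2 by (simp add: power_divide)
  \<comment> \<open>Completing the product of exponentials: the exponents combine to the one with variance \<open>s\<^sup>2\<close>.\<close>
  have e: "- r\<^sup>2 / 2 + - (r / l)\<^sup>2 / 2 = - (r - 0)\<^sup>2 / (2 * s\<^sup>2)"
    unfolding s2 using l l2 by (simp add: field_simps)
  have c: "sqrt (2 / pi) * s * (1 / sqrt (2 * pi * s\<^sup>2)) = 2 * (1 / sqrt (2 * pi)) * (1 / sqrt (2 * pi))"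
    using s by (simp add: real_sqrt_mult real_sqrt_divide field_simps)
  show ?thesis
    unfolding normal_density_def[of 0 s] std_normal_density_def e[symmetric] exp_add mult.assoc[symmetric] c
    by (simp only: ac_simps)
qed

lemma skew_normal_moment_1:
  assumes l: "0 \<le> l"
  shows "skew_normal_moment l 1 = sqrt (2 / pi) * (l / sqrt (1 + l\<^sup>2))"
proof (cases "l = 0")
  case True
  have half: "2 * std_normal_cdf 0 = 1" using std_normal_cdf_minus[of 0] by simp
  then show ?thesis using True integral_std_normal_moment_odd[of 0]
    by (simp add: skew_normal_moment_def half)
next
  case False
  then have l: "0 < l" using l by simp
  let ?s = "l / sqrt (1 + l\<^sup>2)"
  have s: "0 < ?s" using l by (auto intro!: divide_pos_pos real_sqrt_gt_zero add_pos_nonneg)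
  show ?thesis
    unfolding skew_normal_moment_swap[OF l] std_normal_tail_1 std_normal_density_mult[OF l]
    using s by simp
qed

lemma skew_normal_moment_3:
  assumes l: "0 \<le> l"
  shows "skew_normal_moment l 3 =
    sqrt (2 / pi) * (l / sqrt (1 + l\<^sup>2)) * (3 - (l / sqrt (1 + l\<^sup>2))\<^sup>2)"
proof (cases "l = 0")
  case True
  have half: "2 * std_normal_cdf 0 = 1" using std_normal_cdf_minus[of 0] by simp
  then show ?thesis using True integral_std_normal_moment_odd[of 1]
    by (simp add: skew_normal_moment_def half)
next
  case False
  then have l: "0 < l" using l by simp
  let ?s = "l / sqrt (1 + l\<^sup>2)"
  have s: "0 < ?s" using l by (auto intro!: divide_pos_pos real_sqrt_gt_zero add_pos_nonneg)
  have l2: "1 + l\<^sup>2 > 0" by (auto intro: add_pos_nonneg)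
  have s2: "?s\<^sup>2 = l\<^sup>2 / (1 + l\<^sup>2)" using l2 by (simp add: power_divide)
  have "skew_normal_moment l 3 = (\<integral>r. sqrt (2 / pi) * ?s *
      ((1 / l\<^sup>2) * (normal_density 0 ?s r * r ^ 2) + 2 * normal_density 0 ?s r) \<partial>lborel)"
    unfolding skew_normal_moment_swap[OF l] std_normal_tail_3
      mult.assoc[symmetric] std_normal_density_mult[OF l]
    by (intro Bochner_Integration.integral_cong) (auto simp: field_simps power_divide)
  also have "\<dots> = sqrt (2 / pi) * ?s * ((1 / l\<^sup>2) * ?s\<^sup>2 + 2)"
    using integral_normal_moment_even[OF s, of 0 1] integrable_normal_moment[OF s, of 0 2] s
    by (simp add: integrable_normal_density[OF s])
  also have "(1 / l\<^sup>2) * ?s\<^sup>2 + 2 = 3 - ?s\<^sup>2"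
    unfolding s2 using l l2 by (simp add: field_simps)
  finally show ?thesis .
qed

lemma skew_normal_moment_0: "skew_normal_moment l 0 = 1"
  and skew_normal_moment_2: "skew_normal_moment l 2 = 1"
  and skew_normal_moment_4: "skew_normal_moment l 4 = 3"
  using integral_std_normal_moment_even[of 1] integral_std_normal_moment_even[of 2]
  by (simp_all add: skew_normal_moment_even fact_numeral)


section \<open>Homogeneous moments of spherical densities relative to the Gaussian\<close>

lemma radial_integral_0_iff:
  "f \<in> borel_measurable borel \<Longrightarrow> radial_integral n f = 0 \<longleftrightarrow> (AE t in lborel. 0 < t \<longrightarrow> f t = 0)"
  unfolding radial_integral_def
  by (subst nn_integral_0_iff_AE) (auto simp: indicator_def intro!: AE_cong)

text \<open>
  A power of \<open>t\<close> is at most the sum of two powers whose exponents enclose its own.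
\<close>

lemma radial_integral_finite_mono:
  assumes "m1 \<le> m" "m \<le> m2" "radial_integral m1 f < \<infinity>" "radial_integral m2 f < \<infinity>"
    and [measurable]: "f \<in> borel_measurable borel"
  shows "radial_integral m f < \<infinity>"
proof -
  have le: "t powr (real m / 2 - 1) \<le> t powr (real m1 / 2 - 1) + t powr (real m2 / 2 - 1)" if "0 < t" for t
  proof (cases "t \<le> 1")
    case True
    then have "t powr (real m / 2 - 1) \<le> t powr (real m1 / 2 - 1)"
      using that assms(1) by (intro powr_mono') auto
    then show ?thesis using powr_ge_zero[of t "real m2 / 2 - 1"] by linarith
  next
    case False
    then have "t powr (real m / 2 - 1) \<le> t powr (real m2 / 2 - 1)"
      using assms(2) by (intro powr_mono) auto
    then show ?thesis using powr_ge_zero[of t "real m1 / 2 - 1"] by linarith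
  qed
  have "radial_integral m f \<le> radial_integral m1 f + radial_integral m2 f"
    unfolding radial_integral_def
  proof (subst nn_integral_add[symmetric], measurable, intro nn_integral_mono)
    fix t :: real
    show "ennreal (t powr (real m / 2 - 1)) * indicator {0<..} t * f t
       \<le> ennreal (t powr (real m1 / 2 - 1)) * indicator {0<..} t * f t +
         ennreal (t powr (real m2 / 2 - 1)) * indicator {0<..} t * f t"
      using le[of t]
      by (cases "0 < t") (auto simp: distrib_right[symmetric] ennreal_plus[symmetric]
          simp del: ennreal_plus intro!: mult_right_mono ennreal_leI)
  qed
  also have "\<dots> < \<infinity>" using assms by simp
  finally show ?thesis .
qed

text \<open>
  The substitution \<open>t = r\<^sup>2\<close>, obtained as the one-dimensional case of radial integration with a
  weight that vanishes on the negative half-line.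
\<close>

lemma nn_integral_half_line_square:
  assumes [measurable]: "f \<in> borel_measurable borel"
  shows "(\<integral>\<^sup>+r. ennreal (r ^ j) * indicator {0<..} r * f (r\<^sup>2) \<partial>lborel) = ennreal (1 / 2) * radial_integral (Suc j) f"
proof -
  let ?p = "\<lambda>r::real. ennreal (r ^ j) * indicator {0<..} r"
  have C: "(\<integral>\<^sup>+r. ?p r * indicator {r. r \<bullet> r \<le> 1} r \<partial>lborel) = ennreal (1 / real (Suc j))"
  proof -
    have "(\<integral>\<^sup>+r. ?p r * indicator {r. r \<bullet> r \<le> 1} r \<partial>lborel) =
        (\<integral>\<^sup>+s. ennreal (s powr (real (Suc j) - 1)) * indicator {0<..1} s \<partial>lborel)"
      by (intro nn_integral_cong)
         (auto simp: indicator_def powr_realpow abs_square_le_1 power2_eq_square[symmetric])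
    also have "\<dots> = ennreal (1 / real (Suc j))"
      by (subst nn_integral_powr_Ioc) auto
    finally show ?thesis .
  qed
  have "(\<integral>\<^sup>+r. ?p r * f (r \<bullet> r) \<partial>lborel) =
    ennreal (real (DIM(real) + j) / 2) * (\<integral>\<^sup>+r. ?p r * indicator {r. r \<bullet> r \<le> 1} r \<partial>lborel)
      * radial_integral (DIM(real) + j) f"
  proof (rule nn_integral_homogeneous_radial)
    show "?p (s *\<^sub>R x) = ennreal (s ^ j) * ?p x" if "0 < s" for s x
      using that by (auto simp: indicator_def power_mult_distrib ennreal_mult' zero_less_mult_iff)
  qed (use C in auto)
  also have "ennreal (real (DIM(real) + j) / 2) * (\<integral>\<^sup>+r. ?p r * indicator {r. r \<bullet> r \<le> 1} r \<partial>lborel) = ennreal (1 / 2)"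
    unfolding C by (subst ennreal_mult[symmetric]) (auto simp: field_simps)
  finally show ?thesis by (simp add: power2_eq_square)
qed

text \<open>
  The density generator of the standard normal law on an \<open>n\<close>-dimensional space.
\<close>

definition gaussian_generator :: "nat \<Rightarrow> real \<Rightarrow> real" where
  "gaussian_generator n t = exp (- t / 2) / sqrt (2 * pi) ^ n"

lemma gaussian_generator_pos: "0 < gaussian_generator n t"
  unfolding gaussian_generator_def by simp

lemma gaussian_generator_measurable [measurable]: "gaussian_generator n \<in> borel_measurable borel"
  unfolding gaussian_generator_def by measurable

lemma radial_integral_gaussian_pos: "0 < radial_integral m (\<lambda>t. ennreal (gaussian_generator n t))"
proof -
  have "\<not> (AE t::real in lborel. \<not> 0 < t)"
  proof
    assume "AE t::real in lborel. \<not> 0 < t"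
    then have "AE t::real in lborel. t \<notin> {0<..<1}" by eventually_elim auto
    then have "emeasure lborel {0<..<1::real} = 0"
      by (subst (asm) AE_iff_measurable[where N="{0<..<1}"]) auto
    then show False by simp
  qed
  then have "radial_integral m (\<lambda>t. ennreal (gaussian_generator n t)) \<noteq> 0"
    using gaussian_generator_pos[of n]
    by (subst radial_integral_0_iff) (simp_all add: ennreal_eq_0_iff not_le[symmetric])
  then show ?thesis by (simp add: zero_less_iff_neq_zero)
qed

lemma radial_integral_gaussian_finite: "radial_integral (Suc j) (\<lambda>t. ennreal (gaussian_generator n t)) < \<infinity>"
proof -
  have "(\<integral>\<^sup>+r. ennreal (r ^ j) * indicator {0<..} r * ennreal (gaussian_generator n (r\<^sup>2)) \<partial>lborel)
     \<le> (\<integral>\<^sup>+r. ennreal (norm (sqrt (2 * pi) / sqrt (2 * pi) ^ n * (std_normal_density r * r ^ j))) \<partial>lborel)"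
  proof (intro nn_integral_mono)
    fix r :: real
    show "ennreal (r ^ j) * indicator {0<..} r * ennreal (gaussian_generator n (r\<^sup>2)) \<le>
        ennreal (norm (sqrt (2 * pi) / sqrt (2 * pi) ^ n * (std_normal_density r * r ^ j)))"
      by (auto simp: indicator_def std_normal_density_def gaussian_generator_def abs_mult
            ennreal_mult'[symmetric] mult.commute intro!: ennreal_leI)
  qed
  also have "\<dots> < \<infinity>"
    using integrable_mult_right[OF integrable_std_normal_moment[of j], of "sqrt (2 * pi) / sqrt (2 * pi) ^ n"]
    unfolding integrable_iff_bounded by simp
  finally show ?thesis
    by (subst (asm) nn_integral_half_line_square) (auto simp: ennreal_mult_less_top)
qed

text \<open>
  The constant \<open>K\<close>, which is determined by the \<open>q\<close>-mass of the unit ball, is the same for both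
  generators; this is what allows them to be compared.
  Integrability against the Gaussian guarantees that this mass is finite.
\<close>

lemma nn_integral_homogeneous_gaussian_comparison:
  fixes q :: "'v::euclidean_space \<Rightarrow> real"
  assumes [measurable]: "q \<in> borel_measurable borel"
    and nonneg: "\<And>x. 0 \<le> q x"
    and hom: "\<And>s x. 0 < s \<Longrightarrow> q (s *\<^sub>R x) = s ^ m * q x"
    and fin: "integrable lborel (\<lambda>x. q x * gaussian_generator n (x \<bullet> x))"
    and [measurable]: "g \<in> borel_measurable borel"
  shows "\<exists>K<\<infinity>. (\<integral>\<^sup>+x. ennreal (q x) * g (x \<bullet> x) \<partial>lborel) = K * radial_integral (DIM('v) + m) g
     \<and> (\<integral>\<^sup>+x. ennreal (q x) * ennreal (gaussian_generator n (x \<bullet> x)) \<partial>lborel) =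
        K * radial_integral (DIM('v) + m) (\<lambda>t. ennreal (gaussian_generator n t))"
proof -
  let ?C = "\<integral>\<^sup>+x. ennreal (q x) * indicator {x. x \<bullet> x \<le> 1} x \<partial>lborel"
  let ?c = "gaussian_generator n 1"
  have "ennreal ?c * ?C = (\<integral>\<^sup>+x. ennreal ?c * (ennreal (q x) * indicator {x. x \<bullet> x \<le> 1} x) \<partial>lborel)"
    by (subst nn_integral_cmult) auto
  also have "\<dots> \<le> (\<integral>\<^sup>+x. ennreal (q x * gaussian_generator n (x \<bullet> x)) \<partial>lborel)"
  proof (intro nn_integral_mono)
    fix x :: 'v
    have "?c \<le> gaussian_generator n (x \<bullet> x)" if "x \<bullet> x \<le> 1"
      using that unfolding gaussian_generator_def by (intro divide_right_mono) auto
    then show "ennreal ?c * (ennreal (q x) * indicator {x. x \<bullet> x \<le> 1} x) \<le>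
        ennreal (q x * gaussian_generator n (x \<bullet> x))"
      using nonneg[of x] gaussian_generator_pos[of n 1]
      by (auto simp: indicator_def ennreal_mult'[symmetric] mult.commute intro!: ennreal_leI mult_left_mono)
  qed
  also have "\<dots> < \<infinity>"
    using fin nonneg gaussian_generator_pos[of n, THEN less_imp_le]
    unfolding integrable_iff_bounded by (simp add: abs_mult)
  finally have C: "?C < \<infinity>"
    using gaussian_generator_pos[of n 1] by (auto simp: ennreal_mult_less_top)
  have hom': "ennreal (q (s *\<^sub>R x)) = ennreal (s ^ m) * ennreal (q x)" if "0 < s" for s x
    using that nonneg by (simp add: hom ennreal_mult)
  show ?thesis
    using C
    by (intro exI[of _ "ennreal (real (DIM('v) + m) / 2) * ?C"] conjI
        nn_integral_homogeneous_radial[OF _ hom' C])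
       (auto simp: ennreal_mult_less_top)
qed

text \<open>
  Passing from the Gaussian to another generator changes all integrals of homogeneous functions of
  one degree by the same factor. Signed functions are covered because both parts of \<open>q\<close> are
  homogeneous of the same degree.
\<close>

lemma homogeneous_gaussian_comparison:
  fixes q :: "'v::euclidean_space \<Rightarrow> real"
  assumes [measurable]: "q \<in> borel_measurable borel"
    and hom: "\<And>s x. 0 < s \<Longrightarrow> q (s *\<^sub>R x) = s ^ m * q x"
    and fin: "integrable lborel (\<lambda>x. q x * gaussian_generator n (x \<bullet> x))"
    and [measurable]: "g \<in> borel_measurable borel" and g: "\<And>t. 0 \<le> g t"
    and J: "radial_integral (DIM('v) + m) (\<lambda>t. ennreal (g t)) < \<infinity>"
  shows "integrable lborel (\<lambda>x. q x * g (x \<bullet> x)) \<and>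
    (\<integral>x. q x * g (x \<bullet> x) \<partial>lborel) =
      enn2real (radial_integral (DIM('v) + m) (\<lambda>t. ennreal (g t))) /
      enn2real (radial_integral (DIM('v) + m) (\<lambda>t. ennreal (gaussian_generator n t))) *
      (\<integral>x. q x * gaussian_generator n (x \<bullet> x) \<partial>lborel)"
proof -
  let ?J = "radial_integral (DIM('v) + m) (\<lambda>t. ennreal (g t))"
  let ?G = "radial_integral (DIM('v) + m) (\<lambda>t. ennreal (gaussian_generator n t))"
  have "?G < \<infinity>"
    using radial_integral_gaussian_finite[of "DIM('v) + m - 1" n] DIM_positive[where 'a='v]
    by (simp del: DIM_positive)
  then have G: "0 < enn2real ?G"
    using radial_integral_gaussian_pos[of "DIM('v) + m" n] by (simp add: enn2real_positive_iff)
  have pos: "integrable lborel (\<lambda>x. p x * g (x \<bullet> x)) \<and>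
      (\<integral>x. p x * g (x \<bullet> x) \<partial>lborel) =
        enn2real ?J / enn2real ?G * (\<integral>x. p x * gaussian_generator n (x \<bullet> x) \<partial>lborel)"
    if pm [measurable]: "p \<in> borel_measurable borel" and p: "\<And>x. 0 \<le> p x"
      and ph: "\<And>s x. 0 < s \<Longrightarrow> p (s *\<^sub>R x) = s ^ m * p x"
      and pf: "integrable lborel (\<lambda>x. p x * gaussian_generator n (x \<bullet> x))"
    for p :: "'v \<Rightarrow> real"
  proof -
    obtain K where K: "K < \<infinity>"
      and Kg: "(\<integral>\<^sup>+x. ennreal (p x) * ennreal (g (x \<bullet> x)) \<partial>lborel) = K * ?J"
      and KG: "(\<integral>\<^sup>+x. ennreal (p x) * ennreal (gaussian_generator n (x \<bullet> x)) \<partial>lborel) = K * ?G"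
      using nn_integral_homogeneous_gaussian_comparison[OF pm p ph pf, of "\<lambda>t. ennreal (g t)"]
      by auto
    have Kg': "(\<integral>\<^sup>+x. ennreal (p x * g (x \<bullet> x)) \<partial>lborel) = K * ?J"
      using Kg p g by (simp add: ennreal_mult)
    have KG': "(\<integral>\<^sup>+x. ennreal (p x * gaussian_generator n (x \<bullet> x)) \<partial>lborel) = K * ?G"
      using KG p gaussian_generator_pos[of n, THEN less_imp_le] by (simp add: ennreal_mult)
    have int: "integrable lborel (\<lambda>x. p x * g (x \<bullet> x))"
      using p g Kg' K J by (intro integrableI_nonneg) (auto simp: ennreal_mult_less_top)
    have "(\<integral>x. p x * g (x \<bullet> x) \<partial>lborel) = enn2real K * enn2real ?J"
      using p g by (subst integral_eq_nn_integral) (auto simp: Kg' enn2real_mult)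
    moreover have "(\<integral>x. p x * gaussian_generator n (x \<bullet> x) \<partial>lborel) = enn2real K * enn2real ?G"
      using p gaussian_generator_pos[of n, THEN less_imp_le]
      by (subst integral_eq_nn_integral) (auto simp: KG' enn2real_mult)
    ultimately show ?thesis using int G by simp
  qed
  let ?gam = "\<lambda>x::'v. gaussian_generator n (x \<bullet> x)"
  have split: "q x * h = max (q x) 0 * h - max (- q x) 0 * h" for x h
    by (simp add: max_def)
  have int_max: "integrable lborel (\<lambda>x. max (q x) 0 * ?gam x)" "integrable lborel (\<lambda>x. max (- q x) 0 * ?gam x)"
    by (rule Bochner_Integration.integrable_bound[OF fin]; auto simp: abs_mult intro!: mult_right_mono)+
  have hom_max: "max (q (s *\<^sub>R x)) 0 = s ^ m * max (q x) 0" "max (- q (s *\<^sub>R x)) 0 = s ^ m * max (- q x) 0"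
    if "0 < s" for s x
    using zero_less_power[OF that, of m]
    by (auto simp: hom[OF that] max_def zero_le_mult_iff mult_le_0_iff)
  note P1 = pos[OF _ _ hom_max(1) int_max(1)] and P2 = pos[OF _ _ hom_max(2) int_max(2)]
  have i: "integrable lborel (\<lambda>x. max (q x) 0 * g (x \<bullet> x))" "integrable lborel (\<lambda>x. max (- q x) 0 * g (x \<bullet> x))"
    using P1 P2 by auto
  show ?thesis
    unfolding split
    using i int_max P1 P2 by (simp add: Bochner_Integration.integral_diff right_diff_distrib)
qed

text \<open>
  The constant in front does not depend on \<open>m\<close>; only this matters for quotients of moments.
\<close>

lemma radial_variable_moment:
  assumes "distributed N lborel R (\<lambda>r. ennreal (radial_density k g r))"
    and nonneg: "AE \<omega> in N. 0 \<le> R \<omega>"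
    and [measurable]: "g \<in> borel_measurable borel" and g: "\<And>t. 0 \<le> g t"
  shows "(\<integral>\<omega>. R \<omega> ^ m \<partial>N) = pi powr ((real k + 1) / 2) / Gamma ((real k + 1) / 2) *
     enn2real (radial_integral (Suc k + m) (\<lambda>t. ennreal (g t)))"
proof -
  let ?c = "2 * pi powr ((real k + 1) / 2) / Gamma ((real k + 1) / 2)"
  have c: "0 \<le> ?c" by (intro divide_nonneg_nonneg) auto
  have [measurable]: "R \<in> borel_measurable N" using distributed_measurable[OF assms(1)] by simp
  have "(\<integral>\<^sup>+\<omega>. ennreal (R \<omega> ^ m) \<partial>N) = (\<integral>\<^sup>+r. ennreal (radial_density k g r) * ennreal (r ^ m) \<partial>lborel)"
    by (rule distributed_nn_integral[OF assms(1), symmetric]) simp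
  also have "\<dots> = (\<integral>\<^sup>+r. ennreal ?c * (ennreal (r ^ (k + m)) * indicator {0<..} r * ennreal (g (r\<^sup>2))) \<partial>lborel)"
  proof (intro nn_integral_cong)
    fix r :: real
    show "ennreal (radial_density k g r) * ennreal (r ^ m) =
        ennreal ?c * (ennreal (r ^ (k + m)) * indicator {0<..} r * ennreal (g (r\<^sup>2)))"
    proof (cases "0 < r")
      case True
      then have "ennreal ?c * (ennreal (r ^ (k + m)) * indicator {0<..} r * ennreal (g (r\<^sup>2)))
          = ennreal (?c * (r ^ (k + m) * g (r\<^sup>2)))"
        using c g by (simp del: times_divide_eq_left add: ennreal_mult'[symmetric] mult_nonneg_nonneg)
      also have "\<dots> = ennreal (radial_density k g r * r ^ m)"
        using True by (simp add: radial_density_def power_add ac_simps)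
      finally show ?thesis using True by (simp add: ennreal_mult'')
    qed (simp add: radial_density_def)
  qed
  also have "\<dots> = ennreal ?c * (ennreal (1 / 2) * radial_integral (Suc (k + m)) (\<lambda>t. ennreal (g t)))"
    by (subst nn_integral_cmult, measurable, subst nn_integral_half_line_square) auto
  finally have "(\<integral>\<^sup>+\<omega>. ennreal (R \<omega> ^ m) \<partial>N) =
     ennreal ?c * (ennreal (1 / 2) * radial_integral (Suc (k + m)) (\<lambda>t. ennreal (g t)))" .
  moreover have "enn2real (inverse 2) = 1 / 2"
    using enn2real_ennreal[of "1 / 2"] by simp
  ultimately show ?thesis
    using nonneg c
    by (subst integral_eq_nn_integral) (auto simp: enn2real_mult)
qed

lemma chi_moment:
  assumes chi: "chi_distributed M X n" and n: "0 < n"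
  shows "(\<integral>\<omega>. X \<omega> ^ m \<partial>M) = sqrt (2 * pi) ^ n / (2 powr (real n / 2) * Gamma (real n / 2)) *
     enn2real (radial_integral (n + m) (\<lambda>t. ennreal (gaussian_generator n t)))"
proof -
  let ?c = "sqrt (2 * pi) ^ n / (2 powr (real n / 2) * Gamma (real n / 2))"
  have c: "0 \<le> ?c" using n by (intro divide_nonneg_nonneg mult_nonneg_nonneg) auto
  have [measurable]: "X \<in> borel_measurable M" and nonneg: "AE \<omega> in M. 0 \<le> X \<omega>"
    and D: "distributed M lborel (\<lambda>\<omega>. (X \<omega>)\<^sup>2) (\<lambda>x. ennreal (chi_square_density n x))"
    using chi by (auto simp: chi_distributed_def)
  have "(\<integral>\<^sup>+\<omega>. ennreal (X \<omega> ^ m) \<partial>M) = (\<integral>\<^sup>+\<omega>. ennreal (sqrt ((X \<omega>)\<^sup>2) ^ m) \<partial>M)"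
    using nonneg by (intro nn_integral_cong_AE) auto
  also have "\<dots> = (\<integral>\<^sup>+x. ennreal (chi_square_density n x) * ennreal (sqrt x ^ m) \<partial>lborel)"
    by (rule distributed_nn_integral[OF D, symmetric]) simp
  also have "\<dots> = (\<integral>\<^sup>+x. ennreal ?c * (ennreal (x powr (real (n + m) / 2 - 1)) * indicator {0<..} x *
      ennreal (gaussian_generator n x)) \<partial>lborel)"
  proof (intro nn_integral_cong)
    fix x :: real
    show "ennreal (chi_square_density n x) * ennreal (sqrt x ^ m) =
      ennreal ?c * (ennreal (x powr (real (n + m) / 2 - 1)) * indicator {0<..} x * ennreal (gaussian_generator n x))"
    proof (cases "0 < x")
      case True
      have "x powr (real (n + m) / 2 - 1) = x powr (real n / 2 - 1) * x powr (real m / 2)"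
        by (simp add: powr_add[symmetric] add_divide_distrib algebra_simps)
      also have "x powr (real m / 2) = sqrt x ^ m"
        using True by (simp add: powr_half_sqrt[symmetric] powr_realpow[symmetric] powr_powr)
      finally have e: "x powr (real (n + m) / 2 - 1) = x powr (real n / 2 - 1) * sqrt x ^ m" .
      have "ennreal ?c * (ennreal (x powr (real (n + m) / 2 - 1)) * indicator {0<..} x * ennreal (gaussian_generator n x))
          = ennreal (?c * (x powr (real (n + m) / 2 - 1) * gaussian_generator n x))"
        using True c gaussian_generator_pos[of n x] by (simp del: times_divide_eq_left add: ennreal_mult'[symmetric] mult_nonneg_nonneg)
      also have "\<dots> = ennreal (chi_square_density n x * sqrt x ^ m)"
        unfolding e using True by (simp add: chi_square_density_def gaussian_generator_def ac_simps)
      finally show ?thesis using True by (simp add: ennreal_mult'')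
    qed (simp add: chi_square_density_def)
  qed
  also have "\<dots> = ennreal ?c * radial_integral (n + m) (\<lambda>t. ennreal (gaussian_generator n t))"
    unfolding radial_integral_def by (subst nn_integral_cmult) auto
  finally have "(\<integral>\<^sup>+\<omega>. ennreal (X \<omega> ^ m) \<partial>M) =
     ennreal ?c * radial_integral (n + m) (\<lambda>t. ennreal (gaussian_generator n t))" .
  then show ?thesis
    using nonneg c
    by (subst integral_eq_nn_integral) (auto simp: enn2real_mult)
qed


section \<open>Integrals of products of coordinate functions\<close>

lemma
  fixes f :: "'v::euclidean_space \<Rightarrow> real \<Rightarrow> real"
  assumes int: "\<And>b. b \<in> Basis \<Longrightarrow> integrable lborel (f b)"
  shows integrable_lborel_prod: "integrable lborel (\<lambda>x. \<Prod>b\<in>Basis. f b (x \<bullet> b))"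
    and integral_lborel_prod:
      "(\<integral>x. (\<Prod>b\<in>Basis. f b (x \<bullet> b)) \<partial>lborel) = (\<Prod>b\<in>Basis. \<integral>x. f b x \<partial>lborel)"
proof -
  interpret product_sigma_finite "\<lambda>_::'v. lborel :: real measure" ..
  let ?P = "Pi\<^sub>M (Basis :: 'v set) (\<lambda>_. lborel :: real measure)"
  let ?T = "\<lambda>f. \<Sum>b\<in>Basis. f b *\<^sub>R (b::'v)"
  have [measurable]: "f b \<in> borel_measurable borel" if "b \<in> Basis" for b
    using int[OF that] by auto
  have coord: "(\<Prod>b\<in>Basis. f b (?T x \<bullet> b)) = (\<Prod>b\<in>Basis. f b (x b))" for x
    by (intro prod.cong) auto
  show "integrable lborel (\<lambda>x. \<Prod>b\<in>Basis. f b (x \<bullet> b))"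
    unfolding lborel_def[where 'a='v] lborel_eq_real[symmetric] using product_integrable_prod[of Basis f, OF finite_Basis int]
    by (subst integrable_distr_eq) (auto simp: coord)
  show "(\<integral>x. (\<Prod>b\<in>Basis. f b (x \<bullet> b)) \<partial>lborel) = (\<Prod>b\<in>Basis. \<integral>x. f b x \<partial>lborel)"
    unfolding lborel_def[where 'a='v] lborel_eq_real[symmetric] using product_integral_prod[of Basis f, OF finite_Basis int]
    by (subst integral_distr) (auto simp: coord)
qed

lemma
  fixes f :: "'n::finite \<Rightarrow> real \<Rightarrow> real"
  assumes int: "\<And>i. integrable lborel (f i)"
  shows integrable_lborel_prod_vec: "integrable lborel (\<lambda>x::real^'n. \<Prod>i\<in>UNIV. f i (x $ i))"
    and integral_lborel_prod_vec:
      "(\<integral>x. (\<Prod>i\<in>UNIV. f i ((x::real^'n) $ i)) \<partial>lborel) = (\<Prod>i\<in>UNIV. \<integral>x. f i x \<partial>lborel)"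
proof -
  let ?ax = "\<lambda>i::'n. axis i (1::real)"
  define h where "h = (\<lambda>b::real^'n. f (THE i. b = ?ax i))"
  have h: "h (?ax i) = f i" for i
    unfolding h_def by (simp add: axis_eq_axis)
  have B: "(Basis :: (real^'n) set) = range ?ax"
    by (auto simp: Basis_vec_def)
  have inj: "inj ?ax" by (auto simp: inj_on_def axis_eq_axis)
  have reindex: "(\<Prod>b\<in>Basis. q b) = (\<Prod>i\<in>UNIV. q (?ax i))" for q :: "real^'n \<Rightarrow> real"
    unfolding B by (simp add: prod.reindex[OF inj])
  have hint: "integrable lborel (h b)" if "b \<in> Basis" for b
    using that int by (auto simp: B h)
  show "integrable lborel (\<lambda>x::real^'n. \<Prod>i\<in>UNIV. f i (x $ i))"
    using integrable_lborel_prod[of h, OF hint] by (simp add: reindex h inner_axis)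
  show "(\<integral>x. (\<Prod>i\<in>UNIV. f i ((x::real^'n) $ i)) \<partial>lborel) = (\<Prod>i\<in>UNIV. \<integral>x. f i x \<partial>lborel)"
    using integral_lborel_prod[of h, OF hint] by (simp add: reindex h inner_axis)
qed

lemma gaussian_generator_pair:
  fixes u :: "real ^ 'n" and r :: real
  shows "gaussian_generator (CARD('n) + 1) ((u, r) \<bullet> (u, r)) =
    (\<Prod>i\<in>UNIV. std_normal_density (u $ i)) * std_normal_density r"
proof -
  have "(\<Prod>i\<in>UNIV. std_normal_density (u $ i)) =
      (1 / sqrt (2 * pi)) ^ CARD('n) * exp (\<Sum>i\<in>UNIV. - (u $ i)\<^sup>2 / 2)"
    unfolding std_normal_density_def by (simp add: prod_dividef power_one_over exp_sum)
  also have "(\<Sum>i\<in>UNIV. - (u $ i)\<^sup>2 / 2) = - (u \<bullet> u) / 2"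
    by (simp add: inner_vec_def sum_negf sum_divide_distrib power2_eq_square)
  finally have prod: "(\<Prod>i\<in>UNIV. std_normal_density (u $ i)) =
      (1 / sqrt (2 * pi)) ^ CARD('n) * exp (- (u \<bullet> u) / 2)" .
  have "exp (- ((u, r) \<bullet> (u, r)) / 2) = exp (- (u \<bullet> u) / 2) * exp (- r\<^sup>2 / 2)"
    by (simp add: exp_add[symmetric] power2_eq_square add_divide_distrib)
  note pair = this
  show ?thesis
    unfolding prod unfolding gaussian_generator_def pair std_normal_density_def by (simp add: power_one_over)
qed

lemma gaussian_last_coordinate:
  fixes h :: "real \<Rightarrow> real"
  assumes h: "integrable lborel (\<lambda>r. std_normal_density r * h r)" and [measurable]: "h \<in> borel_measurable borel"
  shows "integrable lborel (\<lambda>z::(real^'n) \<times> real. h (snd z) * gaussian_generator (CARD('n) + 1) (z \<bullet> z))"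
      (is "integrable _ ?F")
    and "(\<integral>z. h (snd (z::(real^'n) \<times> real)) * gaussian_generator (CARD('n) + 1) (z \<bullet> z) \<partial>lborel) =
      (\<integral>r. std_normal_density r * h r \<partial>lborel)"
proof -
  let ?P = "\<lambda>u::real^'n. \<Prod>i\<in>UNIV. std_normal_density (u $ i)"
  have slice: "?F (u, r) = ?P u * (std_normal_density r * h r)" for u r
    unfolding gaussian_generator_pair by simp
  have intP: "integrable lborel ?P"
    by (rule integrable_lborel_prod_vec) auto
  have P1: "(\<integral>u. ?P u \<partial>lborel) = 1"
    by (subst integral_lborel_prod_vec) auto
  have P0: "0 \<le> ?P u" for u by (intro prod_nonneg) auto
  have meas: "?F \<in> borel_measurable (lborel \<Otimes>\<^sub>M lborel)"
  proof -
    have [measurable]: "(snd :: (real^'n) \<times> real \<Rightarrow> _) \<in> borel_measurable borel"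
      by (intro borel_measurable_continuous_onI continuous_intros)
    show ?thesis by (simp only: lborel_prod) measurable
  qed
  have I: "integrable (lborel \<Otimes>\<^sub>M lborel) ?F"
  proof (rule lborel_pair.Fubini_integrable[OF meas])
    have "(\<integral>r. norm (?F (u, r)) \<partial>lborel) = ?P u * (\<integral>r. norm (std_normal_density r * h r) \<partial>lborel)" for u
      unfolding slice norm_mult using P0[of u] by simp
    then show "integrable lborel (\<lambda>u. \<integral>r. norm (?F (u, r)) \<partial>lborel)"
      using intP by simp
    show "AE u in lborel. integrable lborel (\<lambda>r. ?F (u, r))"
      unfolding slice using h by auto
  qed
  then show "integrable lborel ?F" by (simp add: lborel_prod)
  have "integral\<^sup>L lborel ?F = (\<integral>u. (\<integral>r. ?F (u, r) \<partial>lborel) \<partial>lborel)"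
    using lborel_pair.integral_fst'[OF I] by (simp add: lborel_prod)
  also have "\<dots> = (\<integral>r. std_normal_density r * h r \<partial>lborel)"
    unfolding slice using P1 by simp
  finally show "integral\<^sup>L lborel ?F = (\<integral>r. std_normal_density r * h r \<partial>lborel)" .
qed

text \<open>
  Let \<open>r\<close> be the last coordinate of a vector with the spherical density. The quotient of order 1 times
  \<open>sqrt (2/\<pi>)\<close> is \<open>E |r|\<close>, the quotient of order 2 is \<open>E r\<^sup>2\<close>, and the variance of \<open>|r|\<close> is nonnegative.
\<close>

lemma spherical_abs_moment_squared_le:
  fixes G :: "real \<Rightarrow> real"
  defines "J \<equiv> \<lambda>m. radial_integral (CARD('n::finite) + 1 + m) (\<lambda>t. ennreal (G t))"
    and "\<Gamma> \<equiv> \<lambda>m. radial_integral (CARD('n) + 1 + m) (\<lambda>t. ennreal (gaussian_generator (CARD('n) + 1) t))"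
  assumes Gm [measurable]: "G \<in> borel_measurable borel" and G0: "\<And>t. 0 \<le> G t"
    and mass: "(\<integral>\<^sup>+z. ennreal (G (z \<bullet> z)) \<partial>(lborel :: ((real^'n) \<times> real) measure)) = 1"
    and J: "J 1 < \<infinity>" "J 2 < \<infinity>"
  shows "(enn2real (J 1) / enn2real (\<Gamma> 1) * sqrt (2 / pi))\<^sup>2 \<le> enn2real (J 2) / enn2real (\<Gamma> 2)"
proof -
  have i1: "integrable lborel (\<lambda>r. std_normal_density r * \<bar>r\<bar>)"
    using integrable_std_normal_moment_abs[of 1] by simp
  have i2: "integrable lborel (\<lambda>r. std_normal_density r * r\<^sup>2)"
    by (rule integrable_std_normal_moment)
  have v1: "(\<integral>r. std_normal_density r * \<bar>r\<bar> \<partial>lborel) = sqrt (2 / pi)"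
    using integral_std_normal_moment_abs_odd[of 0] by simp
  have v2: "(\<integral>r. std_normal_density r * r\<^sup>2 \<partial>lborel) = 1"
    using integral_std_normal_moment_even[of 1] by simp
  have [measurable]: "(snd :: (real^'n) \<times> real \<Rightarrow> _) \<in> borel_measurable borel"
    by (intro borel_measurable_continuous_onI continuous_intros)
  let ?a = "enn2real (J 1) / enn2real (\<Gamma> 1) * sqrt (2 / pi)"
  let ?b = "enn2real (J 2) / enn2real (\<Gamma> 2)"
  have 1: "integrable lborel (\<lambda>z::(real^'n) \<times> real. \<bar>snd z\<bar> * G (z \<bullet> z)) \<and>
      (\<integral>z. \<bar>snd z\<bar> * G ((z::(real^'n) \<times> real) \<bullet> z) \<partial>lborel) = ?a"
    using homogeneous_gaussian_comparison[of "\<lambda>z::(real^'n) \<times> real. \<bar>snd z\<bar>" 1 "CARD('n) + 1" G]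
      gaussian_last_coordinate[OF i1, where 'n='n] v1 J G0
    by (simp add: J_def \<Gamma>_def abs_mult)
  have 2: "integrable lborel (\<lambda>z::(real^'n) \<times> real. (snd z)\<^sup>2 * G (z \<bullet> z)) \<and>
      (\<integral>z. (snd z)\<^sup>2 * G ((z::(real^'n) \<times> real) \<bullet> z) \<partial>lborel) = ?b"
    using homogeneous_gaussian_comparison[of "\<lambda>z::(real^'n) \<times> real. (snd z)\<^sup>2" 2 "CARD('n) + 1" G]
      gaussian_last_coordinate[OF i2, where 'n='n] v2 J G0
    by (simp add: J_def \<Gamma>_def power_mult_distrib)
  have 0: "integrable lborel (\<lambda>z::(real^'n) \<times> real. G (z \<bullet> z))"
    using mass G0 by (intro integrableI_nonneg) auto
  have m: "(\<integral>z. G ((z::(real^'n) \<times> real) \<bullet> z) \<partial>lborel) = 1"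
    using mass G0 by (subst integral_eq_nn_integral) auto
  have "0 \<le> (\<integral>z. (\<bar>snd z\<bar> - ?a)\<^sup>2 * G ((z::(real^'n) \<times> real) \<bullet> z) \<partial>lborel)"
    using G0 by (intro integral_nonneg_AE) auto
  also have "\<dots> = (\<integral>z. (snd z)\<^sup>2 * G ((z::(real^'n) \<times> real) \<bullet> z)
      - 2 * ?a * (\<bar>snd z\<bar> * G (z \<bullet> z)) + ?a\<^sup>2 * G (z \<bullet> z) \<partial>lborel)"
    by (intro Bochner_Integration.integral_cong) (simp_all add: power2_diff algebra_simps)
  also have "\<dots> = ?b - 2 * ?a * ?a + ?a\<^sup>2"
  proof -
    note [simp] = 1[THEN conjunct1] 2[THEN conjunct1] 0
    show ?thesis
      by (subst Bochner_Integration.integral_add, simp, simp, subst Bochner_Integration.integral_diff, simp, simp)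
         (simp only: integral_mult_right_zero 1 2 m mult_1_right)
  qed
  finally have "0 \<le> ?b - 2 * ?a * ?a + ?a\<^sup>2" .
  moreover have "x\<^sup>2 \<le> y" if "0 \<le> y - 2 * x * x + x\<^sup>2" for x y :: real
    using that by (simp add: power2_eq_square)
  ultimately show ?thesis by blast
qed


section \<open>Gaussian monomials under the skewing weight\<close>

text \<open>
  The half-space is bounded by a hyperplane through the origin. Hence the weight is homogeneous of
  degree 0 and can be absorbed into a homogeneous integrand, and the factor 2 gives it mean 1 under
  every spherical law.
\<close>

definition skew_weight :: "real \<Rightarrow> 'n \<Rightarrow> real ^ 'n \<Rightarrow> real \<Rightarrow> real" where
  "skew_weight l i0 u r = 2 * indicator {..l * u $ i0} r"

lemma skew_weight_measurable [measurable]: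
  fixes i0 :: "'n::finite"
  shows "(\<lambda>z. skew_weight l i0 (fst z) (snd z)) \<in> borel_measurable borel"
proof -
  have "(\<lambda>z::(real^'n) \<times> real. 2 * (if snd z \<le> l * (fst z \<bullet> axis i0 1) then 1 else 0) :: real)
      \<in> borel_measurable (borel \<Otimes>\<^sub>M borel)"
    by measurable
  also have "(\<lambda>z::(real^'n) \<times> real. 2 * (if snd z \<le> l * (fst z \<bullet> axis i0 1) then 1 else 0) :: real)
      = (\<lambda>z. skew_weight l i0 (fst z) (snd z))"
    by (auto simp: fun_eq_iff skew_weight_def indicator_def inner_axis)
  finally show ?thesis by (simp add: borel_prod)
qed

lemma skew_weight_scale:
  "0 < s \<Longrightarrow> skew_weight l i0 (s *\<^sub>R u) (s * r) = skew_weight l i0 u r"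
  by (auto simp: skew_weight_def indicator_def mult.left_commute[of l])

definition vec_monomial :: "('n \<Rightarrow> nat) \<Rightarrow> real ^ 'n \<Rightarrow> real" where
  "vec_monomial e u = (\<Prod>i\<in>UNIV. u $ i ^ e i)"

lemma vec_monomial_measurable [measurable]: "vec_monomial e \<in> borel_measurable borel"
  unfolding vec_monomial_def[abs_def]
  by (intro borel_measurable_continuous_onI continuous_intros)

lemma vec_monomial_scale: "vec_monomial e (s *\<^sub>R u) = s ^ (\<Sum>i\<in>UNIV. e i) * vec_monomial e u"
  by (simp add: vec_monomial_def power_mult_distrib prod.distrib power_sum)

text \<open>
  Integrating out \<open>r\<close> turns the weight into \<open>2 \<Phi>(l u\<^bsub>i0\<^esub>)\<close>, which depends on a single coordinate. The
  Gaussian density factorises, hence so does the whole integral.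
\<close>

lemma gaussian_skew_monomial:
  fixes e :: "'n::finite \<Rightarrow> nat"
  shows "integrable lborel (\<lambda>z::(real^'n) \<times> real. skew_weight l i0 (fst z) (snd z) * vec_monomial e (fst z)
      * gaussian_generator (CARD('n) + 1) (z \<bullet> z))" (is "integrable _ ?F")
    and "(\<integral>z. skew_weight l i0 (fst (z :: (real^'n) \<times> real)) (snd z) * vec_monomial e (fst z)
      * gaussian_generator (CARD('n) + 1) (z \<bullet> z) \<partial>lborel) =
      (\<Prod>i\<in>UNIV. skew_normal_moment (if i = i0 then l else 0) (e i))"
proof -
  define f where "f = (\<lambda>i x. std_normal_density x * (2 * std_normal_cdf ((if i = i0 then l else 0) * x)) * x ^ e i)"
  have half: "2 * std_normal_cdf 0 = 1" using std_normal_cdf_minus[of 0] by simp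
  have fprod: "(\<Prod>i\<in>UNIV. f i (u $ i)) = (\<Prod>i\<in>UNIV. std_normal_density (u $ i)) * vec_monomial e u
      * (2 * std_normal_cdf (l * u $ i0))" for u
  proof -
    have "(\<Prod>i\<in>UNIV. 2 * std_normal_cdf ((if i = i0 then l else 0) * u $ i)) =
        (\<Prod>i\<in>UNIV. if i = i0 then 2 * std_normal_cdf (l * u $ i) else 1)"
      by (intro prod.cong) (auto simp: half)
    also have "\<dots> = 2 * std_normal_cdf (l * u $ i0)" by simp
    finally show ?thesis by (simp add: f_def prod.distrib vec_monomial_def)
  qed
  have Fslice: "?F (u, r) = 2 * ((\<Prod>i\<in>UNIV. std_normal_density (u $ i)) * vec_monomial e u) *
      (std_normal_density r * indicator {..l * u $ i0} r)" for u r
    unfolding gaussian_generator_pair by (simp add: skew_weight_def)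
  have int_f: "integrable lborel (f i)" for i
    unfolding f_def by (rule integrable_std_normal_power_cdf)
  have meas: "?F \<in> borel_measurable (lborel \<Otimes>\<^sub>M lborel)"
  proof -
    have [measurable]: "(fst :: (real^'n) \<times> real \<Rightarrow> _) \<in> borel_measurable borel"
      by (intro borel_measurable_continuous_onI continuous_intros)
    show ?thesis by (simp only: lborel_prod) measurable
  qed
  have sl: "integrable lborel (\<lambda>r. ?F (u, r))" for u
    unfolding Fslice by (intro integrable_mult_right integrable_std_normal_indicator) auto
  have sl_int: "(\<integral>r. ?F (u, r) \<partial>lborel) = (\<Prod>i\<in>UNIV. f i (u $ i))" for u
    unfolding Fslice fprod by (simp add: std_normal_cdf_def)
  have sl_norm: "(\<integral>r. norm (?F (u, r)) \<partial>lborel) = norm (\<Prod>i\<in>UNIV. f i (u $ i))" for u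
  proof -
    have "(\<integral>r. norm (?F (u, r)) \<partial>lborel) = (\<integral>r. norm (2 * ((\<Prod>i\<in>UNIV. std_normal_density (u $ i)) * vec_monomial e u)) *
      (std_normal_density r * indicator {..l * u $ i0} r) \<partial>lborel)"
      unfolding Fslice by (intro Bochner_Integration.integral_cong) (auto simp: abs_mult)
    also have "\<dots> = norm (2 * ((\<Prod>i\<in>UNIV. std_normal_density (u $ i)) * vec_monomial e u)) * std_normal_cdf (l * u $ i0)"
      unfolding std_normal_cdf_def by (rule integral_mult_right_zero)
    finally show ?thesis unfolding fprod by (simp add: abs_mult std_normal_cdf_nonneg)
  qed
  have I: "integrable (lborel \<Otimes>\<^sub>M lborel) ?F"
    by (rule lborel_pair.Fubini_integrable[OF meas])
       (use sl sl_norm integrable_norm[OF integrable_lborel_prod_vec[of f, OF int_f]] in auto)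
  then show "integrable lborel ?F" by (simp add: lborel_prod)
  have "integral\<^sup>L lborel ?F = (\<integral>u. (\<integral>r. ?F (u, r) \<partial>lborel) \<partial>lborel)"
    using lborel_pair.integral_fst'[OF I] by (simp add: lborel_prod)
  also have "\<dots> = (\<Prod>i\<in>UNIV. \<integral>x. f i x \<partial>lborel)"
    unfolding sl_int by (rule integral_lborel_prod_vec[of f, OF int_f])
  finally show "integral\<^sup>L lborel ?F = (\<Prod>i\<in>UNIV. skew_normal_moment (if i = i0 then l else 0) (e i))"
    by (simp add: f_def skew_normal_moment_def)
qed

lemma vec_monomial_single: "vec_monomial ((\<lambda>_. 0)(i := p)) u = u $ i ^ p"
proof -
  have "vec_monomial ((\<lambda>_. 0)(i := p)) u = (\<Prod>j\<in>UNIV. if j = i then u $ j ^ p else 1)"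
    unfolding vec_monomial_def by (intro prod.cong) auto
  then show ?thesis by simp
qed

lemma prod_pair:
  fixes h :: "'n::finite \<Rightarrow> nat \<Rightarrow> 'b::comm_monoid_mult"
  assumes "i \<noteq> j" "\<And>k. h k 0 = 1"
  shows "(\<Prod>k\<in>UNIV. h k (((\<lambda>_. 0)(i := p, j := q)) k)) = h i p * h j q"
proof -
  have "(\<Prod>k\<in>UNIV. h k (((\<lambda>_. 0)(i := p, j := q)) k)) = (\<Prod>k\<in>{i, j}. h k (((\<lambda>_. 0)(i := p, j := q)) k))"
    using assms by (intro prod.mono_neutral_right) auto
  then show ?thesis using assms by simp
qed

lemma vec_monomial_pair: "i \<noteq> j \<Longrightarrow> vec_monomial ((\<lambda>_. 0)(i := p, j := q)) u = u $ i ^ p * u $ j ^ q"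
  unfolding vec_monomial_def by (rule prod_pair[of i j "\<lambda>k m. u $ k ^ m"]) auto

lemma sum_pair: "i \<noteq> j \<Longrightarrow> (\<Sum>k\<in>(UNIV::'n::finite set). ((\<lambda>_. 0::nat)(i := p, j := q)) k) = p + q"
proof -
  assume "i \<noteq> j"
  have "(\<Sum>k\<in>UNIV. ((\<lambda>_. 0::nat)(i := p, j := q)) k) = (\<Sum>k\<in>{i, j}. ((\<lambda>_. 0::nat)(i := p, j := q)) k)"
    by (intro sum.mono_neutral_right) auto
  then show ?thesis using \<open>i \<noteq> j\<close> by simp
qed

lemma sum_single: "(\<Sum>k\<in>(UNIV::'n::finite set). ((\<lambda>_. 0::nat)(i := p)) k) = p"
  by (simp add: fun_upd_def)

lemma prod_single_moment:
  "(\<Prod>k\<in>(UNIV::'n::finite set). skew_normal_moment (L k) (((\<lambda>_. 0)(i := p)) k)) = skew_normal_moment (L i) p"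
proof -
  have "(\<Prod>k\<in>(UNIV::'n set). skew_normal_moment (L k) (((\<lambda>_. 0)(i := p)) k)) =
      (\<Prod>k\<in>(UNIV::'n set). if k = i then skew_normal_moment (L k) p else 1)"
    by (intro prod.cong) (auto simp: skew_normal_moment_0)
  then show ?thesis by simp
qed


section \<open>Canonical coordinates\<close>

text \<open>
  For square matrices a one-sided inverse is two-sided, and inverses are unique.
\<close>

lemma matrix_inv_eqI:
  fixes A B :: "real ^ 'n ^ 'n"
  assumes AB: "A ** B = mat 1"
  shows "matrix_inv A = B"
proof -
  have BA: "B ** A = mat 1" using AB by (simp add: matrix_left_right_inverse)
  have "A ** matrix_inv A = mat 1 \<and> matrix_inv A ** A = mat 1"
    unfolding matrix_inv_def by (rule someI[of _ B]) (simp add: AB BA)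
  then have "B ** A ** matrix_inv A = B" by (simp add: matrix_mul_assoc[symmetric])
  then show ?thesis by (simp add: BA)
qed

lemma matrix_inv_symmetric_positive_definite:
  fixes \<Omega> :: "real ^ 'n ^ 'n"
  assumes sym: "transpose \<Omega> = \<Omega>" and pd: "positive_definite \<Omega>"
  shows "\<Omega> ** matrix_inv \<Omega> = mat 1" "matrix_inv \<Omega> ** \<Omega> = mat 1"
    and "transpose (matrix_inv \<Omega>) = matrix_inv \<Omega>"
    and "positive_definite (matrix_inv \<Omega>)"
proof -
  have "x = 0" if "\<Omega> *v x = 0" for x
    using that pd unfolding positive_definite_def by (metis inner_zero_right less_irrefl)
  then have "\<exists>B. B ** \<Omega> = mat 1"
    by (simp add: matrix_left_invertible_ker)
  then obtain B where B: "B ** \<Omega> = mat 1" ..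
  then have "\<Omega> ** B = mat 1" by (simp add: matrix_left_right_inverse)
  then show r: "\<Omega> ** matrix_inv \<Omega> = mat 1" and l: "matrix_inv \<Omega> ** \<Omega> = mat 1"
    using B by (simp_all add: matrix_inv_eqI)
  have "transpose (matrix_inv \<Omega>) ** \<Omega> = mat 1"
    using arg_cong[OF r, of transpose] by (simp add: matrix_transpose_mul sym transpose_mat)
  then have "transpose (matrix_inv \<Omega>) ** (\<Omega> ** matrix_inv \<Omega>) = matrix_inv \<Omega>"
    by (simp add: matrix_mul_assoc)
  then show "transpose (matrix_inv \<Omega>) = matrix_inv \<Omega>"
    by (simp add: r)
  show "positive_definite (matrix_inv \<Omega>)"
    unfolding positive_definite_def
  proof (intro allI impI)
    fix x :: "real ^ 'n" assume x: "x \<noteq> 0"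
    let ?y = "matrix_inv \<Omega> *v x"
    have xy: "x = \<Omega> *v ?y" by (simp add: matrix_vector_mul_assoc r)
    then have "?y \<noteq> 0" using x by auto
    then have "0 < ?y \<bullet> (\<Omega> *v ?y)" using pd unfolding positive_definite_def by blast
    then show "0 < x \<bullet> ?y" using xy by (simp add: inner_commute)
  qed
qed

text \<open>
  Gram--Schmidt orthonormalisation for the inner product given by \<open>W\<close>, started at \<open>\<delta>\<close>. If
  \<open>\<delta> = 0\<close>, any starting vector will do, and the last equation holds because its scalar is 0.
\<close>

lemma gram_schmidt_family:
  fixes W :: "real ^ 'n ^ 'n" and \<delta> :: "real ^ 'n"
  assumes sym: "transpose W = W" and pd: "positive_definite W"
  shows "\<exists>v :: 'n \<Rightarrow> real ^ 'n. (\<forall>i\<in>insert i0 S. \<forall>j\<in>insert i0 S. v i \<bullet> (W *v v j) = of_bool (i = j))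
     \<and> sqrt (\<delta> \<bullet> (W *v \<delta>)) *\<^sub>R v i0 = \<delta>"
proof -
  have pos: "0 < x \<bullet> (W *v x)" if "x \<noteq> 0" for x
    using pd that unfolding positive_definite_def by blast
  have symm: "x \<bullet> (W *v y) = y \<bullet> (W *v x)" for x y
    by (metis sym dot_lmul_matrix inner_commute transpose_matrix_vector)
  define normalize where "normalize x = (1 / sqrt (x \<bullet> (W *v x))) *\<^sub>R x" for x
  have norm1: "normalize x \<bullet> (W *v normalize x) = 1" if "x \<noteq> 0" for x
    using pos[OF that] by (simp add: normalize_def matrix_vector_mult_scaleR)
  have "finite S" by simp
  then show ?thesis
  proof induction
    case empty
    define x where "x = (if \<delta> = 0 then axis i0 1 else \<delta>)"
    have "x \<noteq> 0" by (auto simp: x_def axis_eq_0_iff)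
    moreover have "sqrt (\<delta> \<bullet> (W *v \<delta>)) *\<^sub>R normalize x = \<delta>"
      using pos[of \<delta>] by (cases "\<delta> = 0") (auto simp: x_def normalize_def)
    ultimately show ?case using norm1
      by (intro exI[of _ "\<lambda>_. normalize x"]) auto
  next
    case (insert j S)
    let ?T = "insert i0 S"
    obtain v :: "'n \<Rightarrow> real ^ 'n" where v: "\<And>i j. i \<in> ?T \<Longrightarrow> j \<in> ?T \<Longrightarrow> v i \<bullet> (W *v v j) = of_bool (i = j)"
      and v0: "sqrt (\<delta> \<bullet> (W *v \<delta>)) *\<^sub>R v i0 = \<delta>"
      using insert.IH by blast
    show ?case
    proof (cases "j = i0")
      case True
      then show ?thesis using v v0 by (intro exI[of _ v]) auto
    next
      case False
      then have jT: "j \<notin> ?T" using insert by auto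
      have "dim (span (v ` ?T)) \<le> card ?T"
        using dim_le_card[of "span (v ` ?T)" "v ` ?T"] card_image_le[of ?T v] insert by simp
      also have "card ?T < CARD('n)"
        using jT by (intro psubset_card_mono) auto
      finally have "dim (span (v ` ?T)) < DIM(real ^ 'n)" by simp
      then have "span (v ` ?T) \<noteq> UNIV" by (metis dim_UNIV less_irrefl)
      then obtain x where x: "x \<notin> span (v ` ?T)" by auto
      \<comment> \<open>The component of \<open>x\<close> that is orthogonal to the family found so far.\<close>
      define y where "y = x - (\<Sum>i\<in>?T. (v i \<bullet> (W *v x)) *\<^sub>R v i)"
      have "y \<noteq> 0"
      proof
        assume "y = 0"
        then have "x = (\<Sum>i\<in>?T. (v i \<bullet> (W *v x)) *\<^sub>R v i)" by (simp add: y_def)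
        moreover have "(\<Sum>i\<in>?T. (v i \<bullet> (W *v x)) *\<^sub>R v i) \<in> span (v ` ?T)"
          by (intro span_sum span_scale span_base) auto
        ultimately show False using x by simp
      qed
      have orth: "v i \<bullet> (W *v y) = 0" if "i \<in> ?T" for i
      proof -
        have "v i \<bullet> (W *v (\<Sum>k\<in>?T. (v k \<bullet> (W *v x)) *\<^sub>R v k)) =
            (\<Sum>k\<in>?T. (v k \<bullet> (W *v x)) * (v i \<bullet> (W *v v k)))"
          by (simp only: linear_sum[OF matrix_vector_mul_linear] o_def matrix_vector_mult_scaleR inner_sum_right inner_scaleR_right)
        also have "\<dots> = (\<Sum>k\<in>?T. if k = i then v k \<bullet> (W *v x) else 0)"
          using v that by (intro sum.cong) auto
        also have "\<dots> = v i \<bullet> (W *v x)"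
          using that insert by (simp only: sum.delta finite_insert if_True)
        finally show ?thesis
          by (simp add: y_def matrix_vector_mult_diff_distrib inner_diff_right)
      qed
      have orth': "v i \<bullet> (W *v normalize y) = 0" "normalize y \<bullet> (W *v v i) = 0" if "i \<in> ?T" for i
        using orth[OF that] symm[of "v i" "normalize y"] by (simp_all add: normalize_def matrix_vector_mult_scaleR)
      have "i0 \<noteq> j" using False by simp
      then show ?thesis
        using v v0 jT norm1[OF \<open>y \<noteq> 0\<close>] orth'
        by (intro exI[of _ "v(j := normalize y)"]) (auto simp: eq_commute[of j])
    qed
  qed
qed

text \<open>
  The columns of \<open>A\<close> are orthonormal for \<open>\<Omega>\<^sup>-\<^sup>1\<close>, so \<open>A\<^sup>-\<^sup>1 = A\<^sup>T \<Omega>\<^sup>-\<^sup>1\<close> whitens the quadratic form; the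
  column \<open>i0\<close> points in the direction of the skewness vector.
\<close>

lemma canonical_factor:
  fixes i0 :: "'n::finite" and \<Omega> :: "real ^ 'n ^ 'n" and \<delta> :: "real ^ 'n"
  assumes "transpose \<Omega> = \<Omega>" "positive_definite \<Omega>"
  obtains A where "transpose A ** matrix_inv \<Omega> ** A = mat 1"
    and "A ** (transpose A ** matrix_inv \<Omega>) = mat 1"
    and "A *v axis i0 (delta_star \<Omega> \<delta>) = \<delta>"
proof -
  note inv = matrix_inv_symmetric_positive_definite[OF assms]
  let ?W = "matrix_inv \<Omega>"
  obtain v :: "'n \<Rightarrow> real ^ 'n" where v: "\<And>i j. v i \<bullet> (?W *v v j) = of_bool (i = j)"
    and v0: "sqrt (\<delta> \<bullet> (?W *v \<delta>)) *\<^sub>R v i0 = \<delta>"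
    using gram_schmidt_family[OF inv(3,4), of i0 UNIV \<delta>] by auto
  define A where "A = (\<chi> r c. v c $ r)"
  have col: "A *v axis i s = s *\<^sub>R v i" for i s
    by (simp add: A_def vec_eq_iff matrix_vector_mult_def axis_def if_distrib if_distribR mult.commute
        cong: if_cong)
  have AWA: "transpose A ** ?W ** A = mat 1"
  proof -
    have "(transpose A ** (?W ** A)) $ i $ j = (mat 1 :: real^'n^'n) $ i $ j" for i j
    proof -
      have "(transpose A ** (?W ** A)) $ i $ j = v i \<bullet> (?W *v v j)"
        by (simp add: A_def transpose_def matrix_matrix_mult_def matrix_vector_mult_def inner_vec_def)
      then show ?thesis by (simp add: v mat_def)
    qed
    then show ?thesis by (simp add: vec_eq_iff matrix_mul_assoc)
  qed
  have right: "A ** (transpose A ** ?W) = mat 1"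
    using AWA by (simp add: matrix_left_right_inverse)
  show thesis
    using that[of A] AWA right v0 by (simp add: col delta_star_def)
qed


section \<open>Linear change of variables for Lebesgue measure\<close>

text \<open>
  The usual uniqueness argument for Haar measure: integrate \<open>f(x) h(y)\<close> against \<open>\<mu> \<otimes> lborel\<close>, shift \<open>x\<close>
  by \<open>y\<close>, exchange the integrals, and shift \<open>y\<close> by \<open>-x\<close>.
\<close>

lemma nn_integral_translation_invariant:
  fixes \<mu> :: "'v::euclidean_space measure"
  assumes sets [measurable_cong]: "sets \<mu> = sets borel" and sf: "sigma_finite_measure \<mu>"
    and inv: "\<And>t f. f \<in> borel_measurable borel \<Longrightarrow> (\<integral>\<^sup>+x. f (x + t) \<partial>\<mu>) = (\<integral>\<^sup>+x. f x \<partial>\<mu>)"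
    and refl: "\<And>f. f \<in> borel_measurable borel \<Longrightarrow> (\<integral>\<^sup>+x. f (- x) \<partial>\<mu>) = (\<integral>\<^sup>+x. f x \<partial>\<mu>)"
    and [measurable]: "f \<in> borel_measurable borel" "h \<in> borel_measurable borel"
  shows "(\<integral>\<^sup>+x. f x \<partial>\<mu>) * (\<integral>\<^sup>+x. h x \<partial>lborel) = (\<integral>\<^sup>+x. f x \<partial>lborel) * (\<integral>\<^sup>+x. h x \<partial>\<mu>)"
proof -
  interpret \<mu>: sigma_finite_measure \<mu> by fact
  interpret P: pair_sigma_finite \<mu> "lborel :: 'v measure" ..
  have "(\<integral>\<^sup>+x. f x \<partial>\<mu>) * (\<integral>\<^sup>+y. h y \<partial>lborel) = (\<integral>\<^sup>+y. (\<integral>\<^sup>+x. f x * h y \<partial>\<mu>) \<partial>lborel)"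
    by (simp add: nn_integral_cmult nn_integral_multc)
  also have "\<dots> = (\<integral>\<^sup>+y. (\<integral>\<^sup>+x. f (x + y) * h y \<partial>\<mu>) \<partial>lborel)"
  proof (rule nn_integral_cong)
    fix y :: 'v
    show "(\<integral>\<^sup>+x. f x * h y \<partial>\<mu>) = (\<integral>\<^sup>+x. f (x + y) * h y \<partial>\<mu>)"
      using inv[of "\<lambda>x. f x * h y" y] by simp
  qed
  also have "\<dots> = (\<integral>\<^sup>+x. (\<integral>\<^sup>+y. f (x + y) * h y \<partial>lborel) \<partial>\<mu>)"
    by (rule P.Fubini') measurable
  also have "\<dots> = (\<integral>\<^sup>+x. (\<integral>\<^sup>+y. f y * h (y - x) \<partial>lborel) \<partial>\<mu>)"
  proof (rule nn_integral_cong)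
    fix x :: 'v
    have "(\<integral>\<^sup>+y. f y * h (y - x) \<partial>lborel) = (\<integral>\<^sup>+y. f y * h (y - x) \<partial>distr lborel borel ((+) x))"
      by (simp add: lborel_distr_plus)
    also have "\<dots> = (\<integral>\<^sup>+y. f (x + y) * h y \<partial>lborel)"
      by (simp add: nn_integral_distr)
    finally show "(\<integral>\<^sup>+y. f (x + y) * h y \<partial>lborel) = (\<integral>\<^sup>+y. f y * h (y - x) \<partial>lborel)" ..
  qed
  also have "\<dots> = (\<integral>\<^sup>+y. (\<integral>\<^sup>+x. f y * h (y - x) \<partial>\<mu>) \<partial>lborel)"
    by (rule P.Fubini'[symmetric]) measurable
  also have "\<dots> = (\<integral>\<^sup>+y. f y * (\<integral>\<^sup>+x. h x \<partial>\<mu>) \<partial>lborel)"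
  proof (rule nn_integral_cong)
    fix y :: 'v
    have "(\<integral>\<^sup>+x. h (y - x) \<partial>\<mu>) = (\<integral>\<^sup>+x. (\<lambda>x. h (x + y)) (- x) \<partial>\<mu>)" by simp
    also have "\<dots> = (\<integral>\<^sup>+x. h x \<partial>\<mu>)"
      by (subst refl) (simp_all add: inv)
    finally show "(\<integral>\<^sup>+x. f y * h (y - x) \<partial>\<mu>) = f y * (\<integral>\<^sup>+x. h x \<partial>\<mu>)"
      by (simp add: nn_integral_cmult)
  qed
  also have "\<dots> = (\<integral>\<^sup>+x. f x \<partial>lborel) * (\<integral>\<^sup>+x. h x \<partial>\<mu>)"
    by (simp add: nn_integral_multc)
  finally show ?thesis .
qed

text \<open>
  The image of Lebesgue measure under a linear bijection is translation invariant and therefore a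
  multiple of it. The constant is the inverse of the absolute determinant; in the application it is identified
  by the total mass of a probability density instead.
\<close>

lemma nn_integral_lborel_linear:
  fixes L L' :: "'v::euclidean_space \<Rightarrow> 'v"
  assumes L: "linear L" and L': "linear L'" and inv: "\<And>x. L (L' x) = x" "\<And>x. L' (L x) = x"
  shows "\<exists>c. \<forall>f\<in>borel_measurable borel. (\<integral>\<^sup>+x. f (L x) \<partial>lborel) = c * (\<integral>\<^sup>+x. f x \<partial>lborel)"
proof -
  have [measurable]: "L \<in> borel_measurable borel" "L' \<in> borel_measurable borel"
    using L L' by (auto intro!: borel_measurable_continuous_onI linear_continuous_on simp: linear_conv_bounded_linear)
  let ?\<mu> = "distr lborel borel L"
  let ?h = "indicator (cbox 0 One) :: 'v \<Rightarrow> ennreal"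
  have sf: "sigma_finite_measure ?\<mu>"
  proof
    let ?A = "range (\<lambda>n::nat. L ` cball 0 (real n))"
    have eq: "L ` S = L' -` S" for S using inv by (auto simp: image_iff) metis
    have bs: "L ` cball 0 (real n) \<in> sets borel" for n
      unfolding eq using measurable_sets_borel[of L' borel "cball 0 (real n)"] by simp
    have "emeasure ?\<mu> (L ` cball 0 (real n)) \<noteq> \<infinity>" for n
    proof -
      have "L -` L ` cball 0 (real n) = cball 0 (real n)"
        using inv by auto (metis imageE inv(2))
      then show ?thesis
        using bs[of n] emeasure_bounded_finite[of "cball 0 (real n) :: 'v set"]
        by (simp add: emeasure_distr)
    qed
    moreover have "\<Union> ?A = space ?\<mu>"
    proof -
      have "x \<in> \<Union> ?A" for x
      proof -
        obtain n where "norm (L' x) \<le> real n" using real_arch_simple by blast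
        then have "x \<in> L ` cball 0 (real n)" using inv by (auto simp: image_iff intro!: bexI[of _ "L' x"])
        then show ?thesis by auto
      qed
      then show ?thesis by auto
    qed
    ultimately show "\<exists>A. countable A \<and> A \<subseteq> sets ?\<mu> \<and> \<Union> A = space ?\<mu> \<and> (\<forall>a\<in>A. emeasure ?\<mu> a \<noteq> \<infinity>)"
      using bs by (intro exI[of _ ?A]) auto
  qed
  have main: "(\<integral>\<^sup>+x. f x \<partial>?\<mu>) * (\<integral>\<^sup>+x. ?h x \<partial>lborel) = (\<integral>\<^sup>+x. f x \<partial>lborel) * (\<integral>\<^sup>+x. ?h x \<partial>?\<mu>)"
    if [measurable]: "f \<in> borel_measurable borel" for f
  proof (rule nn_integral_translation_invariant[OF _ sf])
    show "(\<integral>\<^sup>+x. q (x + t) \<partial>?\<mu>) = (\<integral>\<^sup>+x. q x \<partial>?\<mu>)" if [measurable]: "q \<in> borel_measurable borel" for q t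
    proof -
      have "(\<integral>\<^sup>+x. q (x + t) \<partial>?\<mu>) = (\<integral>\<^sup>+x. q (L (L' t + x)) \<partial>lborel)"
        by (simp add: nn_integral_distr linear_add[OF L] inv add.commute)
      also have "\<dots> = (\<integral>\<^sup>+x. q (L x) \<partial>distr lborel borel ((+) (L' t)))"
        by (simp add: nn_integral_distr)
      finally show ?thesis by (simp add: lborel_distr_plus nn_integral_distr)
    qed
    show "(\<integral>\<^sup>+x. q (- x) \<partial>?\<mu>) = (\<integral>\<^sup>+x. q x \<partial>?\<mu>)" if [measurable]: "q \<in> borel_measurable borel" for q
    proof -
      have "(\<integral>\<^sup>+x. q (- x) \<partial>?\<mu>) = (\<integral>\<^sup>+x. q (L (- x)) \<partial>lborel)"
        by (simp add: nn_integral_distr linear_neg[OF L])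
      also have "\<dots> = (\<integral>\<^sup>+x. q (L x) \<partial>distr lborel borel uminus)"
        by (simp add: nn_integral_distr)
      also have "distr lborel borel uminus = (lborel :: 'v measure)"
        using lborel_affine[of "-1" "0::'v"] by (simp add: density_1)
      finally show ?thesis by (simp add: nn_integral_distr)
    qed
  qed auto
  have box: "(\<integral>\<^sup>+x. ?h x \<partial>lborel) = 1"
    by (simp add: emeasure_lborel_cbox)
  show ?thesis
    using main unfolding box
    by (intro exI[of _ "\<integral>\<^sup>+x. ?h x \<partial>?\<mu>"]) (simp add: nn_integral_distr mult.commute)
qed

section \<open>The law of the vector in canonical coordinates\<close>

text \<open>
  A generator is constrained on the nonnegative half-line only, and its measurability is that of
  \<open>x \<mapsto> g (x \<bullet> x)\<close>. Composing with the absolute value yields a Borel function on the whole line that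
  agrees with \<open>g\<close> wherever \<open>g\<close> is evaluated.
\<close>

lemma spherical_generator_abs_measurable:
  assumes "spherical_density_generator TYPE('v::euclidean_space) g"
  shows "(\<lambda>t. g \<bar>t\<bar>) \<in> borel_measurable borel"
proof -
  obtain e :: 'v where e: "norm e = 1" using vector_choose_size[of 1] by auto
  have [measurable]: "(\<lambda>x::'v. g (x \<bullet> x)) \<in> borel_measurable borel"
    using assms unfolding spherical_density_generator_def by auto
  have [measurable]: "(\<lambda>t. sqrt \<bar>t\<bar> *\<^sub>R e) \<in> borel_measurable borel" by measurable
  have "(\<lambda>t. g ((sqrt \<bar>t\<bar> *\<^sub>R e) \<bullet> (sqrt \<bar>t\<bar> *\<^sub>R e))) \<in> borel_measurable borel"
    by (rule measurable_compose[of "\<lambda>t. sqrt \<bar>t\<bar> *\<^sub>R e" borel borel "\<lambda>x. g (x \<bullet> x)"]) measurable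
  moreover have "(sqrt \<bar>t\<bar> *\<^sub>R e) \<bullet> (sqrt \<bar>t\<bar> *\<^sub>R e) = \<bar>t\<bar>" for t
    using e by (simp add: norm_eq_1)
  ultimately show ?thesis by simp
qed

text \<open>
  Both generators have total mass 1, and the total mass is the same multiple of both radial integrals.
\<close>

lemma radial_integral_spherical_eq_gaussian:
  fixes g :: "real \<Rightarrow> real"
  assumes [measurable]: "g \<in> borel_measurable borel"
    and mass: "(\<integral>\<^sup>+z. ennreal (g (z \<bullet> z)) \<partial>(lborel :: ((real^'n) \<times> real) measure)) = 1"
  shows "radial_integral (CARD('n) + 1) (\<lambda>t. ennreal (g t)) =
      radial_integral (CARD('n) + 1) (\<lambda>t. ennreal (gaussian_generator (CARD('n) + 1) t))"
proof -
  let ?gam = "gaussian_generator (CARD('n) + 1)"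
  have int: "integrable lborel (\<lambda>z::(real^'n) \<times> real. 1 * ?gam (z \<bullet> z))"
    and val: "(\<integral>z. 1 * ?gam ((z::(real^'n) \<times> real) \<bullet> z) \<partial>lborel) = 1"
    using gaussian_last_coordinate[of "\<lambda>_. 1", where 'n='n] by auto
  have gmass: "(\<integral>\<^sup>+z. ennreal (?gam (z \<bullet> z)) \<partial>(lborel :: ((real^'n) \<times> real) measure)) = 1"
    using nn_integral_eq_integral[OF int] val gaussian_generator_pos[of "CARD('n) + 1", THEN less_imp_le]
    by simp
  obtain K where K: "K < \<infinity>" and 1: "1 = K * radial_integral (CARD('n) + 1) (\<lambda>t. ennreal (g t))"
    and 2: "1 = K * radial_integral (CARD('n) + 1) (\<lambda>t. ennreal (?gam t))"
    using nn_integral_homogeneous_gaussian_comparison[of "\<lambda>_::(real^'n) \<times> real. 1" 0 "CARD('n) + 1"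
        "\<lambda>t. ennreal (g t)"] int mass gmass by auto
  have "K \<noteq> 0" using 1 by auto
  then show ?thesis
    using K 1 2 by (metis ennreal_mult_cancel_left infinity_ennreal_def less_irrefl)
qed

text \<open>
  The moments of \<open>R\<close> and \<open>R\<^sub>0\<close> are constant multiples of the radial integrals of \<open>g\<close> and of the Gaussian
  generator. The zeroth moments are 1 and the zeroth radial integrals coincide, so the two constants
  are equal and cancel.
\<close>

lemma moment_ratio:
  fixes g :: "real \<Rightarrow> real"
  assumes "prob_space N" "prob_space N0"
    and nonneg: "AE \<omega> in N. 0 \<le> R \<omega>"
    and R: "distributed N lborel R (\<lambda>r. ennreal (radial_density CARD('n::finite) g r))"
    and R0: "chi_distributed N0 R0 (CARD('n) + 1)"
    and meas: "g \<in> borel_measurable borel" and g: "\<And>t. 0 \<le> g t"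
    and mass: "(\<integral>\<^sup>+z. ennreal (g (z \<bullet> z)) \<partial>(lborel :: ((real^'n) \<times> real) measure)) = 1"
  shows "enn2real (radial_integral (CARD('n) + 1 + m) (\<lambda>t. ennreal (g t))) /
      enn2real (radial_integral (CARD('n) + 1 + m) (\<lambda>t. ennreal (gaussian_generator (CARD('n) + 1) t)))
    = (\<integral>\<omega>. R \<omega> ^ m \<partial>N) / (\<integral>\<omega>. R0 \<omega> ^ m \<partial>N0)"
proof -
  interpret N: prob_space N by fact
  interpret N0: prob_space N0 by fact
  let ?J = "\<lambda>m. enn2real (radial_integral (CARD('n) + 1 + m) (\<lambda>t. ennreal (g t)))"
  let ?G = "\<lambda>m. enn2real (radial_integral (CARD('n) + 1 + m) (\<lambda>t. ennreal (gaussian_generator (CARD('n) + 1) t)))"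
  obtain c1 where c1: "\<And>m. (\<integral>\<omega>. R \<omega> ^ m \<partial>N) = c1 * ?J m"
    using radial_variable_moment[OF R nonneg meas g]
    by (intro that[of "pi powr ((real CARD('n) + 1) / 2) / Gamma ((real CARD('n) + 1) / 2)"]) simp
  obtain c2 where c2: "\<And>m. (\<integral>\<omega>. R0 \<omega> ^ m \<partial>N0) = c2 * ?G m"
    using chi_moment[OF R0]
    by (intro that[of "sqrt (2 * pi) ^ (CARD('n) + 1) /
        (2 powr (real (CARD('n) + 1) / 2) * Gamma (real (CARD('n) + 1) / 2))"]) simp
  have "?J 0 = ?G 0" using radial_integral_spherical_eq_gaussian[OF meas mass] by simp
  moreover have "c1 * ?J 0 = 1" "c2 * ?G 0 = 1"
    using c1[of 0] c2[of 0] by (simp_all add: N.prob_space N0.prob_space)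
  ultimately have "c1 = c2" "c1 \<noteq> 0"
    by (metis mult_cancel_right mult_zero_right zero_neq_one, auto)
  then show ?thesis unfolding c1 c2 by simp
qed

text \<open>
  In the coordinates \<open>B (y - \<mu>)\<close> with \<open>B = A\<^sup>-\<^sup>1\<close>, the quadratic form of the density becomes \<open>u \<bullet> u\<close>
  and the upper limit of integration becomes \<open>l u\<^bsub>i0\<^esub>\<close>. Thus the law is a marginal of a skewed spherical density.
\<close>

lemma skew_elliptical_canonical_nn_integral:
  fixes Y :: "'a \<Rightarrow> real ^ 'n" and A :: "real ^ 'n ^ 'n"
  assumes "prob_space M"
    and se: "skew_elliptical M Y \<mu> \<Omega> \<delta> g"
    and A1: "transpose A ** matrix_inv \<Omega> ** A = mat 1"
    and A2: "A ** (transpose A ** matrix_inv \<Omega>) = mat 1"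
    and A3: "A *v axis i0 (delta_star \<Omega> \<delta>) = \<delta>"
    and [measurable]: "f \<in> borel_measurable borel"
  defines "G \<equiv> \<lambda>t. g \<bar>t\<bar>"
    and "B \<equiv> transpose A ** matrix_inv \<Omega>"
    and "l \<equiv> delta_star \<Omega> \<delta> / sqrt (1 - (delta_star \<Omega> \<delta>)\<^sup>2)"
  shows "(\<integral>\<^sup>+\<omega>. f (B *v (Y \<omega> - \<mu>)) \<partial>M) =
     (\<integral>\<^sup>+z. f (fst z) * ennreal (skew_weight l i0 (fst z) (snd z) * G (z \<bullet> z)) \<partial>lborel)"
proof -
  interpret prob_space M by fact
  have sym: "transpose \<Omega> = \<Omega>" and pd: "positive_definite \<Omega>"
    and lt1: "\<delta> \<bullet> (matrix_inv \<Omega> *v \<delta>) < 1"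
    and sph: "spherical_density_generator TYPE((real ^ 'n) \<times> real) g"
    and D: "distributed M lborel Y (skew_elliptical_density \<mu> \<Omega> \<delta> g)"
    using se unfolding skew_elliptical_def by auto
  note inv = matrix_inv_symmetric_positive_definite[OF sym pd]
  have Gm [measurable]: "G \<in> borel_measurable borel"
    unfolding G_def by (rule spherical_generator_abs_measurable[OF sph])
  have G0: "0 \<le> G t" for t using sph unfolding G_def spherical_density_generator_def by auto
  have Gmass: "(\<integral>\<^sup>+z. ennreal (G (z \<bullet> z)) \<partial>(lborel :: ((real^'n) \<times> real) measure)) = 1"
    using sph unfolding G_def spherical_density_generator_def by simp
  have AB: "A *v (B *v z) = z" and BA: "B *v (A *v z) = z" for z
    using A1 A2 by (simp_all add: matrix_vector_mul_assoc B_def)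
  have [measurable]: "(\<lambda>z. Q *v z) \<in> borel_measurable borel" for Q :: "real ^ 'n ^ 'n"
    by (intro borel_measurable_continuous_onI linear_continuous_on)
       (simp add: linear_conv_bounded_linear[symmetric])
  have Ym [measurable]: "Y \<in> borel_measurable M" using distributed_measurable[OF D] by simp
  have sedm [measurable]: "skew_elliptical_density \<mu> \<Omega> \<delta> g \<in> borel_measurable borel"
    using distributed_borel_measurable[OF D] by simp
  have ds2: "(delta_star \<Omega> \<delta>)\<^sup>2 = \<delta> \<bullet> (matrix_inv \<Omega> *v \<delta>)"
    using inv(4) unfolding delta_star_def positive_definite_def
    by (cases "\<delta> = 0") (auto simp: less_imp_le)
  define C where "C = ennreal (det \<Omega> powr (- 1 / 2))"
  define w where "w z = ennreal (skew_weight l i0 (fst z) (snd z) * G (z \<bullet> z))" for z :: "(real^'n) \<times> real"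
  define k where "k u = (\<integral>\<^sup>+r. w (u, r) \<partial>lborel)" for u
  have fstm [measurable]: "(fst :: (real^'n) \<times> real \<Rightarrow> _) \<in> borel_measurable borel"
    by (intro borel_measurable_continuous_onI continuous_intros)
  have w_borel [measurable]: "w \<in> borel_measurable borel"
    unfolding w_def[abs_def] by measurable
  then have wm: "w \<in> borel_measurable (borel \<Otimes>\<^sub>M borel)"
    by (simp add: borel_prod)
  have km [measurable]: "k \<in> borel_measurable borel"
    unfolding k_def using wm by measurable
  have sed: "skew_elliptical_density \<mu> \<Omega> \<delta> g (A *v u + \<mu>) = C * k u" for u
  proof -
    have quad: "(A *v u) \<bullet> (matrix_inv \<Omega> *v (A *v x)) = u \<bullet> x" for u x
    proof -
      have "u \<bullet> ((transpose A ** matrix_inv \<Omega> ** A) *v x) = ((matrix_inv \<Omega> *v (A *v x)) v* A) \<bullet> u"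
        by (simp add: matrix_vector_mul_assoc[symmetric] transpose_matrix_vector[symmetric] inner_commute
            del: transpose_matrix_vector)
      also have "\<dots> = (A *v u) \<bullet> (matrix_inv \<Omega> *v (A *v x))"
        by (subst dot_lmul_matrix) (rule inner_commute)
      finally show ?thesis by (simp add: A1)
    qed
    have "(\<delta> v* matrix_inv \<Omega>) \<bullet> (A *v u) = (A *v axis i0 (delta_star \<Omega> \<delta>)) \<bullet> (matrix_inv \<Omega> *v (A *v u))"
      by (simp add: A3 dot_lmul_matrix)
    also have "\<dots> = delta_star \<Omega> \<delta> * u $ i0"
      by (simp add: quad inner_axis')
    finally have "skew_elliptical_alpha \<Omega> \<delta> \<bullet> (A *v u) = l * u $ i0"
      unfolding skew_elliptical_alpha_def l_def ds2 by simp
    moreover have "g (r\<^sup>2 + u \<bullet> u) = G ((u, r) \<bullet> (u, r))" for r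
      unfolding G_def by (simp add: power2_eq_square add.commute)
    ultimately show ?thesis
      unfolding skew_elliptical_density_def C_def k_def w_def
      by (simp add: quad ennreal_mult' skew_weight_def nn_integral_cmult[symmetric] ac_simps)
         (intro nn_integral_cong, auto simp: indicator_def ac_simps)
  qed
  obtain c where c: "\<And>h. h \<in> borel_measurable borel \<Longrightarrow> (\<integral>\<^sup>+x. h (B *v x) \<partial>lborel) = c * (\<integral>\<^sup>+x. h x \<partial>lborel)"
    using nn_integral_lborel_linear[of "(*v) B" "(*v) A"] AB BA by auto
  have main: "(\<integral>\<^sup>+\<omega>. h (B *v (Y \<omega> - \<mu>)) \<partial>M) =
      C * c * (\<integral>\<^sup>+z. h (fst z) * w z \<partial>lborel)"
    if hm [measurable]: "h \<in> borel_measurable borel" for h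
  proof -
    have "(\<integral>\<^sup>+\<omega>. h (B *v (Y \<omega> - \<mu>)) \<partial>M) =
        (\<integral>\<^sup>+y. skew_elliptical_density \<mu> \<Omega> \<delta> g y * h (B *v (y - \<mu>)) \<partial>lborel)"
      by (rule distributed_nn_integral[OF D, symmetric]) measurable
    also have "\<dots> = (\<integral>\<^sup>+y. skew_elliptical_density \<mu> \<Omega> \<delta> g y * h (B *v (y - \<mu>)) \<partial>distr lborel borel ((+) \<mu>))"
      by (simp add: lborel_distr_plus)
    also have "\<dots> = (\<integral>\<^sup>+z. skew_elliptical_density \<mu> \<Omega> \<delta> g (z + \<mu>) * h (B *v z) \<partial>lborel)"
      by (subst nn_integral_distr) (auto simp: add.commute)
    also have "\<dots> = (\<integral>\<^sup>+z. (\<lambda>u. skew_elliptical_density \<mu> \<Omega> \<delta> g (A *v u + \<mu>) * h u) (B *v z) \<partial>lborel)"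
      by (simp add: AB)
    also have "\<dots> = c * (\<integral>\<^sup>+u. C * k u * h u \<partial>lborel)"
      by (subst c) (measurable, simp add: sed)
    also have "(\<integral>\<^sup>+u. C * k u * h u \<partial>lborel) = C * (\<integral>\<^sup>+u. h u * k u \<partial>lborel)"
      by (subst nn_integral_cmult[symmetric]) (auto simp: ac_simps)
    also have "(\<integral>\<^sup>+u. h u * k u \<partial>lborel) = (\<integral>\<^sup>+u. (\<integral>\<^sup>+r. (\<lambda>z. h (fst z) * w z) (u, r) \<partial>lborel) \<partial>lborel)"
      unfolding k_def using wm by (simp add: nn_integral_cmult)
    also have "\<dots> = (\<integral>\<^sup>+z. h (fst z) * w z \<partial>(lborel \<Otimes>\<^sub>M lborel))"
      by (rule lborel.nn_integral_fst) (simp add: lborel_prod)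
    finally show ?thesis by (simp add: lborel_prod ac_simps)
  qed
  have "(\<integral>\<^sup>+z. w z \<partial>lborel) = 1"
  proof -
    let ?gam = "gaussian_generator (CARD('n) + 1)"
    let ?w = "\<lambda>z::(real^'n) \<times> real. skew_weight l i0 (fst z) (snd z)"
    have mono: "vec_monomial (\<lambda>_. 0) u = 1" for u :: "real^'n" by (simp add: vec_monomial_def)
    have w0: "0 \<le> ?w z" for z by (simp add: skew_weight_def)
    have int: "integrable lborel (\<lambda>z. ?w z * ?gam (z \<bullet> z))"
      and val: "(\<integral>z. ?w z * ?gam (z \<bullet> z) \<partial>lborel) = 1"
      using gaussian_skew_monomial[of l i0 "\<lambda>_. 0"] by (simp_all add: mono skew_normal_moment_even)
    obtain K where "(\<integral>\<^sup>+z. ennreal (?w z) * ennreal (G (z \<bullet> z)) \<partial>lborel) =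
        K * radial_integral (DIM((real^'n) \<times> real) + 0) (\<lambda>t. ennreal (G t))"
      and "(\<integral>\<^sup>+z. ennreal (?w z) * ennreal (?gam (z \<bullet> z)) \<partial>lborel) =
        K * radial_integral (DIM((real^'n) \<times> real) + 0) (\<lambda>t. ennreal (?gam t))"
      using nn_integral_homogeneous_gaussian_comparison[of ?w 0 "CARD('n) + 1" "\<lambda>t. ennreal (G t)"]
        int w0 by (auto simp: skew_weight_scale)
    then have "(\<integral>\<^sup>+z. w z \<partial>lborel) = (\<integral>\<^sup>+z. ennreal (?w z * ?gam (z \<bullet> z)) \<partial>lborel)"
      using radial_integral_spherical_eq_gaussian[OF Gm Gmass] w0
      by (simp add: w_def ennreal_mult')
    also have "\<dots> = 1"
      using nn_integral_eq_integral[OF int] val w0 gaussian_generator_pos[of "CARD('n) + 1", THEN less_imp_le]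
      by simp
    finally show ?thesis .
  qed
  \<comment> \<open>Testing with the constant 1 identifies the product of the density constant and the Jacobian factor.\<close>
  then have "C * c = 1"
    using main[of "\<lambda>_. 1"] by (simp add: emeasure_space_1)
  then show ?thesis using main[of f] by (simp add: w_def)
qed

text \<open>
  The integrand together with the skewing weight is homogeneous, so its expectation is the quotient of
  radial integrals of the same order times the skew-normal moment.
\<close>

lemma skew_elliptical_canonical_expectation:
  fixes Y :: "'a \<Rightarrow> real ^ 'n" and A :: "real ^ 'n ^ 'n" and e :: "'n \<Rightarrow> nat"
  assumes "prob_space M"
    and se: "skew_elliptical M Y \<mu> \<Omega> \<delta> g"
    and A: "transpose A ** matrix_inv \<Omega> ** A = mat 1"
      "A ** (transpose A ** matrix_inv \<Omega>) = mat 1"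
      "A *v axis i0 (delta_star \<Omega> \<delta>) = \<delta>"
    and J: "radial_integral (CARD('n) + 1 + (\<Sum>i\<in>UNIV. e i)) (\<lambda>t. ennreal (g \<bar>t\<bar>)) < \<infinity>"
  defines "B \<equiv> transpose A ** matrix_inv \<Omega>"
    and "l \<equiv> delta_star \<Omega> \<delta> / sqrt (1 - (delta_star \<Omega> \<delta>)\<^sup>2)"
  shows "integrable M (\<lambda>\<omega>. vec_monomial e (B *v (Y \<omega> - \<mu>))) \<and>
     (\<integral>\<omega>. vec_monomial e (B *v (Y \<omega> - \<mu>)) \<partial>M) =
      enn2real (radial_integral (CARD('n) + 1 + (\<Sum>i\<in>UNIV. e i)) (\<lambda>t. ennreal (g \<bar>t\<bar>))) /
      enn2real (radial_integral (CARD('n) + 1 + (\<Sum>i\<in>UNIV. e i)) (\<lambda>t. ennreal (gaussian_generator (CARD('n) + 1) t))) *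
      (\<Prod>i\<in>UNIV. skew_normal_moment (if i = i0 then l else 0) (e i))"
proof -
  have sph: "spherical_density_generator TYPE((real ^ 'n) \<times> real) g"
    and D: "distributed M lborel Y (skew_elliptical_density \<mu> \<Omega> \<delta> g)"
    using se unfolding skew_elliptical_def by auto
  have Gm [measurable]: "(\<lambda>t. g \<bar>t\<bar>) \<in> borel_measurable borel"
    by (rule spherical_generator_abs_measurable[OF sph])
  have G0: "0 \<le> g \<bar>t\<bar>" for t using sph unfolding spherical_density_generator_def by auto
  have [measurable]: "(\<lambda>z. Q *v z) \<in> borel_measurable borel" for Q :: "real ^ 'n ^ 'n"
    by (intro borel_measurable_continuous_onI linear_continuous_on)
       (simp add: linear_conv_bounded_linear[symmetric])
  have [measurable]: "Y \<in> borel_measurable M" using distributed_measurable[OF D] by simp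
  have [measurable]: "(fst :: (real^'n) \<times> real \<Rightarrow> _) \<in> borel_measurable borel"
    by (intro borel_measurable_continuous_onI continuous_intros)
  let ?V = "\<lambda>\<omega>. B *v (Y \<omega> - \<mu>)"
  let ?w = "\<lambda>z::(real^'n) \<times> real. skew_weight l i0 (fst z) (snd z) * g \<bar>z \<bullet> z\<bar>"
  let ?q = "\<lambda>z::(real^'n) \<times> real. skew_weight l i0 (fst z) (snd z) * vec_monomial e (fst z)"
  have w0: "0 \<le> ?w z" for z using G0[of "z \<bullet> z"] by (simp add: skew_weight_def)
  note nn = skew_elliptical_canonical_nn_integral[OF assms(1) se A, folded B_def l_def]
  have law: "distr M borel ?V = distr (density lborel ?w) borel fst"
  proof (rule measure_eqI)
    fix S assume "S \<in> sets (distr M borel ?V)"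
    then have [measurable]: "S \<in> sets borel" by simp
    have "emeasure (distr M borel ?V) S = (\<integral>\<^sup>+x. indicator S x \<partial>distr M borel ?V)"
      by simp
    also have "\<dots> = (\<integral>\<^sup>+\<omega>. indicator S (?V \<omega>) \<partial>M)"
      by (rule nn_integral_distr) measurable
    also have "\<dots> = (\<integral>\<^sup>+z. indicator S (fst z) * ennreal (?w z) \<partial>lborel)"
      by (rule nn) simp
    also have "\<dots> = (\<integral>\<^sup>+z. ennreal (?w z) * indicator S (fst z) \<partial>lborel)"
      by (simp only: mult.commute)
    also have "\<dots> = (\<integral>\<^sup>+z. indicator S (fst z) \<partial>density lborel ?w)"
      by (rule nn_integral_density[symmetric]) measurable
    also have "\<dots> = (\<integral>\<^sup>+x. indicator S x \<partial>distr (density lborel ?w) borel fst)"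
      by (rule nn_integral_distr[symmetric]) measurable
    also have "\<dots> = emeasure (distr (density lborel ?w) borel fst) S"
      by simp
    finally show "emeasure (distr M borel ?V) S = emeasure (distr (density lborel ?w) borel fst) S" .
  qed simp
  have cmp: "integrable lborel (\<lambda>z. ?q z * g \<bar>z \<bullet> z\<bar>) \<and>
    (\<integral>z. ?q z * g \<bar>z \<bullet> z\<bar> \<partial>lborel) =
      enn2real (radial_integral (DIM((real^'n) \<times> real) + (\<Sum>i\<in>UNIV. e i)) (\<lambda>t. ennreal (g \<bar>t\<bar>))) /
      enn2real (radial_integral (DIM((real^'n) \<times> real) + (\<Sum>i\<in>UNIV. e i)) (\<lambda>t. ennreal (gaussian_generator (CARD('n) + 1) t))) *
      (\<integral>z. ?q z * gaussian_generator (CARD('n) + 1) (z \<bullet> z) \<partial>lborel)"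
    using J gaussian_skew_monomial(1)[of l i0 e] G0
    by (intro homogeneous_gaussian_comparison)
       (auto simp: skew_weight_scale vec_monomial_scale)
  have qe: "?q z * g \<bar>z \<bullet> z\<bar> = ?w z * vec_monomial e (fst z)" for z by simp
  have wm: "?w \<in> borel_measurable lborel" and vm: "(\<lambda>z::(real^'n) \<times> real. vec_monomial e (fst z)) \<in> borel_measurable lborel"
    by measurable
  have "integrable (density lborel ?w) (\<lambda>z. vec_monomial e (fst z))"
    using cmp by (subst integrable_density[OF vm wm AE_I2[OF w0]]) (simp only: qe real_scaleR_def)
  then have "integrable (distr M borel ?V) (vec_monomial e)"
    unfolding law by (subst integrable_distr_eq) simp_all
  moreover have "(\<integral>x. vec_monomial e x \<partial>distr M borel ?V) = (\<integral>z. ?q z * g \<bar>z \<bullet> z\<bar> \<partial>lborel)"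
  proof -
    have "(\<integral>x. vec_monomial e x \<partial>distr M borel ?V) = (\<integral>z. vec_monomial e (fst z) \<partial>density lborel ?w)"
      unfolding law by (rule integral_distr) measurable
    also have "\<dots> = (\<integral>z. ?q z * g \<bar>z \<bullet> z\<bar> \<partial>lborel)"
      by (subst integral_density[OF vm wm AE_I2[OF w0]]) (simp only: qe real_scaleR_def)
    finally show ?thesis .
  qed
  ultimately show ?thesis
    using cmp gaussian_skew_monomial(2)[of l i0 e]
    by (simp add: integrable_distr_eq integral_distr)
qed

lemma integrable_norm_power4_moments:
  fixes Y :: "'a \<Rightarrow> real ^ 'n"
  assumes "moments_exist M Y 4"
  shows "integrable M (\<lambda>\<omega>. norm (Y \<omega>) ^ 4)"
proof -
  have "norm (Y \<omega>) ^ 4 = (\<Sum>i\<in>UNIV. \<Sum>j\<in>UNIV. (\<Prod>k\<leftarrow>[i,i,j,j]. Y \<omega> $ k))" for \<omega>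
  proof -
    have "norm (Y \<omega>) ^ 4 = (Y \<omega> \<bullet> Y \<omega>)\<^sup>2"
      by (simp add: power2_norm_eq_inner[symmetric] power_mult[symmetric])
    then show ?thesis
      by (simp add: inner_vec_def power2_eq_square sum_product mult.assoc)
  qed
  moreover have "integrable M (\<lambda>\<omega>. \<Prod>k\<leftarrow>[i,i,j,j]. Y \<omega> $ k)" for i j
    using assms unfolding moments_exist_def by (auto simp del: prod_list.Cons list.map)
  ultimately show ?thesis by (simp only:) (intro Bochner_Integration.integrable_sum)
qed

text \<open>
  The fourth power of the coordinate \<open>i0\<close> of the canonical vector is integrable, being bounded by
  a multiple of \<open>|Y|\<^sup>4 + |\<mu>|\<^sup>4\<close>. Its expectation is a constant times the radial integral in
  question, and the constant is nonzero because the corresponding Gaussian moment is 3.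
\<close>

lemma fourth_radial_moment_finite:
  fixes Y :: "'a \<Rightarrow> real ^ 'n" and A :: "real ^ 'n ^ 'n" and i0 :: 'n
  assumes "prob_space M"
    and se: "skew_elliptical M Y \<mu> \<Omega> \<delta> g"
    and A: "transpose A ** matrix_inv \<Omega> ** A = mat 1"
      "A ** (transpose A ** matrix_inv \<Omega>) = mat 1"
      "A *v axis i0 (delta_star \<Omega> \<delta>) = \<delta>"
    and mom: "moments_exist M Y 4"
  shows "radial_integral (CARD('n) + 1 + 4) (\<lambda>t. ennreal (g \<bar>t\<bar>)) < \<infinity>"
proof -
  interpret prob_space M by fact
  define B where "B = transpose A ** matrix_inv \<Omega>"
  define l where "l = delta_star \<Omega> \<delta> / sqrt (1 - (delta_star \<Omega> \<delta>)\<^sup>2)"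
  have sph: "spherical_density_generator TYPE((real ^ 'n) \<times> real) g"
    and D: "distributed M lborel Y (skew_elliptical_density \<mu> \<Omega> \<delta> g)"
    using se unfolding skew_elliptical_def by auto
  have [measurable]: "(\<lambda>t. g \<bar>t\<bar>) \<in> borel_measurable borel"
    by (rule spherical_generator_abs_measurable[OF sph])
  have G0: "0 \<le> g \<bar>t\<bar>" for t using sph unfolding spherical_density_generator_def by auto
  have [measurable]: "(\<lambda>z. Q *v z) \<in> borel_measurable borel" for Q :: "real ^ 'n ^ 'n"
    by (intro borel_measurable_continuous_onI linear_continuous_on)
       (simp add: linear_conv_bounded_linear[symmetric])
  have [measurable]: "Y \<in> borel_measurable M" using distributed_measurable[OF D] by simp
  let ?e = "(\<lambda>_. 0)(i0 := 4::nat)"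
  let ?q = "\<lambda>z::(real^'n) \<times> real. skew_weight l i0 (fst z) (snd z) * vec_monomial ?e (fst z)"
  obtain b where b: "0 < b" "\<And>x. norm (B *v x) \<le> b * norm x"
    using linear_bounded_pos[of "(*v) B"] by auto
  have "integrable M (\<lambda>\<omega>. vec_monomial ?e (B *v (Y \<omega> - \<mu>)))"
  proof (rule Bochner_Integration.integrable_bound)
    show "integrable M (\<lambda>\<omega>. 8 * b ^ 4 * (norm (Y \<omega>) ^ 4 + norm \<mu> ^ 4))"
      using integrable_norm_power4_moments[OF mom] by simp
    have "norm (vec_monomial ?e (B *v (Y \<omega> - \<mu>))) \<le> norm (8 * b ^ 4 * (norm (Y \<omega>) ^ 4 + norm \<mu> ^ 4))" for \<omega>
    proof -
      have "\<bar>(B *v (Y \<omega> - \<mu>)) $ i0\<bar> \<le> norm (B *v (Y \<omega> - \<mu>))" by (rule component_le_norm_cart)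
      also have "\<dots> \<le> b * norm (Y \<omega> - \<mu>)" by (rule b)
      also have "\<dots> \<le> b * (norm (Y \<omega>) + norm \<mu>)"
        using b(1) norm_triangle_ineq4 by (intro mult_left_mono) auto
      finally have "\<bar>(B *v (Y \<omega> - \<mu>)) $ i0\<bar> ^ 4 \<le> (b * (norm (Y \<omega>) + norm \<mu>)) ^ 4"
        by (intro power_mono) auto
      also have "\<dots> \<le> 8 * b ^ 4 * (norm (Y \<omega>) ^ 4 + norm \<mu> ^ 4)"
      proof -
        have "(x + y) ^ 4 \<le> 8 * (x ^ 4 + y ^ 4)" for x y :: real
        proof -
          have "(x + y)\<^sup>2 \<le> 2 * (x\<^sup>2 + y\<^sup>2)"
            using zero_le_power2[of "x - y"] by (simp add: power2_eq_square algebra_simps)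
          then have "((x + y)\<^sup>2)\<^sup>2 \<le> (2 * (x\<^sup>2 + y\<^sup>2))\<^sup>2" by (intro power_mono) auto
          also have "\<dots> \<le> 8 * ((x\<^sup>2)\<^sup>2 + (y\<^sup>2)\<^sup>2)"
            using zero_le_power2[of "x\<^sup>2 - y\<^sup>2"] by (simp add: power2_eq_square algebra_simps)
          finally show ?thesis by (simp add: power_mult[symmetric])
        qed
        from mult_left_mono[OF this[of "norm (Y \<omega>)" "norm \<mu>"], of "b ^ 4"] b(1)
        show ?thesis by (simp add: power_mult_distrib ac_simps)
      qed
      finally show ?thesis using b(1) by (simp add: vec_monomial_single power_abs)
    qed
    then show "AE \<omega> in M. norm (vec_monomial ?e (B *v (Y \<omega> - \<mu>))) \<le> norm (8 * b ^ 4 * (norm (Y \<omega>) ^ 4 + norm \<mu> ^ 4))"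
      by simp
  qed measurable
  then have fin: "(\<integral>\<^sup>+\<omega>. ennreal (vec_monomial ?e (B *v (Y \<omega> - \<mu>))) \<partial>M) < \<infinity>"
    unfolding integrable_iff_bounded by (simp add: vec_monomial_single)
  have q0: "0 \<le> ?q z" for z by (simp add: skew_weight_def vec_monomial_single)
  have "(\<integral>\<^sup>+\<omega>. ennreal (vec_monomial ?e (B *v (Y \<omega> - \<mu>))) \<partial>M) =
     (\<integral>\<^sup>+z. ennreal (vec_monomial ?e (fst z)) * ennreal (skew_weight l i0 (fst z) (snd z) * g \<bar>z \<bullet> z\<bar>) \<partial>lborel)"
    unfolding B_def l_def
    by (rule skew_elliptical_canonical_nn_integral[OF assms(1) se A, of "\<lambda>u. ennreal (vec_monomial ?e u)"]) measurable
  also have "\<dots> = (\<integral>\<^sup>+z. ennreal (?q z) * ennreal (g \<bar>z \<bullet> z\<bar>) \<partial>lborel)"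
  proof (rule nn_integral_cong)
    fix z :: "(real^'n) \<times> real"
    have s0: "0 \<le> skew_weight l i0 (fst z) (snd z)" and v0: "0 \<le> vec_monomial ?e (fst z)"
      by (simp_all add: skew_weight_def vec_monomial_single)
    show "ennreal (vec_monomial ?e (fst z)) * ennreal (skew_weight l i0 (fst z) (snd z) * g \<bar>z \<bullet> z\<bar>) =
        ennreal (?q z) * ennreal (g \<bar>z \<bullet> z\<bar>)"
      unfolding ennreal_mult[OF s0 G0] ennreal_mult[OF s0 v0] by (simp only: ac_simps)
  qed
  finally have finq: "(\<integral>\<^sup>+z. ennreal (?q z) * ennreal (g \<bar>z \<bullet> z\<bar>) \<partial>lborel) < \<infinity>" using fin by simp
  note gauss = gaussian_skew_monomial[of l i0 ?e]
  have hom: "?q (s *\<^sub>R z) = s ^ 4 * ?q z" if "0 < s" for s z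
    using that by (simp add: skew_weight_scale vec_monomial_scale sum_single del: fun_upd_apply)
  have [measurable]: "(fst :: (real^'n) \<times> real \<Rightarrow> _) \<in> borel_measurable borel"
    by (intro borel_measurable_continuous_onI continuous_intros)
  obtain K where K: "K < \<infinity>"
    and Kg: "(\<integral>\<^sup>+z. ennreal (?q z) * ennreal (g \<bar>z \<bullet> z\<bar>) \<partial>lborel) =
       K * radial_integral (DIM((real^'n) \<times> real) + 4) (\<lambda>t. ennreal (g \<bar>t\<bar>))"
    and KG: "(\<integral>\<^sup>+z. ennreal (?q z) * ennreal (gaussian_generator (CARD('n) + 1) (z \<bullet> z)) \<partial>lborel) =
       K * radial_integral (DIM((real^'n) \<times> real) + 4) (\<lambda>t. ennreal (gaussian_generator (CARD('n) + 1) t))"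
    using nn_integral_homogeneous_gaussian_comparison[of ?q 4 "CARD('n) + 1" "\<lambda>t. ennreal (g \<bar>t\<bar>)", OF _ q0 hom gauss(1)]
    by auto
  have "(\<integral>\<^sup>+z. ennreal (?q z) * ennreal (gaussian_generator (CARD('n) + 1) (z \<bullet> z)) \<partial>lborel) = ennreal 3"
  proof -
    have "(\<integral>\<^sup>+z. ennreal (?q z * gaussian_generator (CARD('n) + 1) (z \<bullet> z)) \<partial>lborel) = ennreal 3"
      using nn_integral_eq_integral[OF gauss(1)] gauss(2) q0 gaussian_generator_pos[of "CARD('n) + 1", THEN less_imp_le]
      by (simp add: prod_single_moment skew_normal_moment_4 del: fun_upd_apply)
    then show ?thesis using q0 gaussian_generator_pos[of "CARD('n) + 1", THEN less_imp_le]
      by (simp add: ennreal_mult)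
  qed
  then have "K \<noteq> 0" using KG by auto
  then show ?thesis
    using finq unfolding Kg by (auto simp: ennreal_mult_less_top)
qed

section \<open>Mardia's kurtosis with diagonal covariance\<close>

text \<open>
  The covariance matrix of \<open>\<mu> + A V\<close> is \<open>A D A\<^sup>T\<close> with \<open>D\<close> diagonal, so the quadratic form in its
  inverse sees \<open>V\<close> only: \<open>A\<close> cancels.
\<close>

lemma mardia_kurtosis_affine_diagonal:
  fixes Y V :: "'a \<Rightarrow> real ^ 'n" and A B :: "real ^ 'n ^ 'n" and v :: "'n \<Rightarrow> real"
  assumes "prob_space M"
    and Y: "\<And>\<omega>. Y \<omega> = \<mu> + A *v V \<omega>" and AB: "A ** B = mat 1"
    and int1: "\<And>k. integrable M (\<lambda>\<omega>. V \<omega> $ k)"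
    and mean: "\<And>k. (\<integral>\<omega>. V \<omega> $ k \<partial>M) = \<xi> $ k"
    and int2: "\<And>k l. integrable M (\<lambda>\<omega>. (V \<omega> $ k - \<xi> $ k) * (V \<omega> $ l - \<xi> $ l))"
    and cov: "\<And>k l. (\<integral>\<omega>. (V \<omega> $ k - \<xi> $ k) * (V \<omega> $ l - \<xi> $ l) \<partial>M) = (if k = l then v k else 0)"
    and v: "\<And>k. v k \<noteq> 0"
  shows "mardia_kurtosis M Y = (\<integral>\<omega>. (\<Sum>k\<in>UNIV. (V \<omega> $ k - \<xi> $ k)\<^sup>2 / v k)\<^sup>2 \<partial>M)"
proof -
  interpret prob_space M by fact
  have m: "mean_vector M Y = \<mu> + A *v \<xi>"
    unfolding mean_vector_def
    by (simp add: vec_eq_iff Y matrix_vector_mult_def int1 mean prob_space)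
  have dev: "Y \<omega> - mean_vector M Y = A *v (V \<omega> - \<xi>)" for \<omega>
    unfolding m Y by (simp add: matrix_vector_mult_diff_distrib)
  define D :: "real ^ 'n ^ 'n" where "D = (\<chi> i j. if i = j then v i else 0)"
  define D' :: "real ^ 'n ^ 'n" where "D' = (\<chi> i j. if i = j then 1 / v i else 0)"
  have diag: "(\<Sum>k\<in>UNIV. x k * (if k = l then y k else 0)) = x l * y l"
    "(\<Sum>k\<in>UNIV. x k * (if l = k then y k else 0)) = x l * y l"
    "(\<Sum>k\<in>UNIV. (if l = k then z else 0) * x k) = z * x l" for x y :: "'n \<Rightarrow> real" and z l
  proof -
    have "(\<Sum>k\<in>UNIV. x k * (if k = l then y k else 0)) = (\<Sum>k\<in>UNIV. if k = l then x k * y k else 0)"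
      "(\<Sum>k\<in>UNIV. x k * (if l = k then y k else 0)) = (\<Sum>k\<in>UNIV. if k = l then x k * y k else 0)"
      "(\<Sum>k\<in>UNIV. (if l = k then z else 0) * x k) = (\<Sum>k\<in>UNIV. if k = l then z * x k else 0)"
      by (intro sum.cong; auto)+
    then show "(\<Sum>k\<in>UNIV. x k * (if k = l then y k else 0)) = x l * y l"
      "(\<Sum>k\<in>UNIV. x k * (if l = k then y k else 0)) = x l * y l"
      "(\<Sum>k\<in>UNIV. (if l = k then z else 0) * x k) = z * x l"
      by simp_all
  qed
  have DD': "D ** D' = mat 1"
  proof -
    have "(D ** D') $ i $ j = (mat 1 :: real ^ 'n ^ 'n) $ i $ j" for i j
    proof -
      have "(D ** D') $ i $ j = (\<Sum>k\<in>UNIV. (if i = k then v i else 0) * (if k = j then 1 / v k else 0))"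
        by (simp add: D_def D'_def matrix_matrix_mult_def)
      also have "\<dots> = (if i = j then v i else 0) * (1 / v j)"
        by (rule diag(1))
      finally show ?thesis by (simp add: mat_def v)
    qed
    then show ?thesis by (simp add: vec_eq_iff)
  qed
  have cm: "covariance_matrix M Y = A ** D ** transpose A"
  proof -
    have "covariance_matrix M Y $ i $ j = (A ** D ** transpose A) $ i $ j" for i j
    proof -
      have "covariance_matrix M Y $ i $ j =
          (\<integral>\<omega>. (A *v (V \<omega> - \<xi>)) $ i * (A *v (V \<omega> - \<xi>)) $ j \<partial>M)"
        unfolding covariance_matrix_def dev[symmetric] by simp
      also have "\<dots> = (\<integral>\<omega>. (\<Sum>k\<in>UNIV. \<Sum>l\<in>UNIV. A $ i $ k * A $ j $ l *
           ((V \<omega> $ k - \<xi> $ k) * (V \<omega> $ l - \<xi> $ l))) \<partial>M)"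
        unfolding matrix_vector_mult_def by (simp add: sum_product mult.assoc mult.left_commute)
      also have "\<dots> = (\<Sum>k\<in>UNIV. \<Sum>l\<in>UNIV. A $ i $ k * A $ j $ l * (if k = l then v k else 0))"
        by (simp only: integral_mult_right_zero cov int2 Bochner_Integration.integral_sum
            Bochner_Integration.integrable_sum integrable_mult_right)
      also have "\<dots> = (\<Sum>k\<in>UNIV. A $ i $ k * v k * A $ j $ k)"
        by (simp only: diag(2)[of _ _ "\<lambda>_. v _"]) (simp only: ac_simps)
      also have "\<dots> = (A ** D ** transpose A) $ i $ j"
        unfolding matrix_matrix_mult_def transpose_def D_def by (simp add: diag(1))
      finally show ?thesis .
    qed
    then show ?thesis by (simp add: vec_eq_iff)
  qed
  have BA: "B ** A = mat 1" using AB by (simp add: matrix_left_right_inverse)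
  have tAB: "transpose A ** transpose B = mat 1"
    using BA by (simp add: matrix_transpose_mul[symmetric] transpose_mat)
  have "covariance_matrix M Y ** (transpose B ** D' ** B) = A ** D ** (transpose A ** transpose B) ** D' ** B"
    unfolding cm by (simp only: matrix_mul_assoc)
  also have "\<dots> = A ** (D ** D') ** B"
    unfolding tAB by (simp add: matrix_mul_assoc)
  also have "\<dots> = mat 1" by (simp add: DD' AB)
  finally have inv: "matrix_inv (covariance_matrix M Y) = transpose B ** D' ** B"
    by (rule matrix_inv_eqI)
  have quad: "(A *v x) \<bullet> ((transpose B ** D' ** B) *v (A *v x)) = (\<Sum>k\<in>UNIV. (x $ k)\<^sup>2 / v k)" for x
  proof -
    have "(transpose B ** D' ** B) *v (A *v x) = transpose B *v (D' *v ((B ** A) *v x))"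
      by (simp add: matrix_vector_mul_assoc matrix_mul_assoc)
    also have "\<dots> = (D' *v x) v* B"
      by (simp add: BA)
    finally have "(A *v x) \<bullet> ((transpose B ** D' ** B) *v (A *v x)) = ((D' *v x) v* B) \<bullet> (A *v x)"
      by (simp only: inner_commute)
    also have "\<dots> = (D' *v x) \<bullet> ((B ** A) *v x)"
      by (subst dot_lmul_matrix) (simp add: matrix_vector_mul_assoc)
    also have "\<dots> = (\<Sum>k\<in>UNIV. (x $ k)\<^sup>2 / v k)"
      unfolding BA matrix_vector_mul_lid unfolding D'_def inner_vec_def matrix_vector_mult_def
      by (simp add: diag(3) power2_eq_square)
    finally show ?thesis .
  qed
  show ?thesis
    unfolding mardia_kurtosis_def inv dev quad by simp
qed

text \<open>
  In the block without \<open>i0\<close>, the \<open>k - 1\<close> diagonal entries \<open>3 s\<close> and the \<open>(k - 1)(k - 2)\<close> other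
  entries \<open>s\<close> add up to \<open>(k - 1)(k + 1) s\<close>.
\<close>

lemma double_sum_distinguished:
  fixes F :: "'n::finite \<Rightarrow> 'n \<Rightarrow> real"
  assumes "F i0 i0 = p" and "\<And>k. k \<noteq> i0 \<Longrightarrow> F i0 k = q" and "\<And>k. k \<noteq> i0 \<Longrightarrow> F k i0 = q"
    and "\<And>k. k \<noteq> i0 \<Longrightarrow> F k k = 3 * s"
    and "\<And>k l. k \<noteq> i0 \<Longrightarrow> l \<noteq> i0 \<Longrightarrow> k \<noteq> l \<Longrightarrow> F k l = s"
  shows "(\<Sum>k\<in>UNIV. \<Sum>l\<in>UNIV. F k l) =
    p + 2 * (real CARD('n) - 1) * q + ((real CARD('n))\<^sup>2 - 1) * s"
proof -
  let ?U = "UNIV - {i0}"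
  have card: "real (card ?U) = real CARD('n) - 1"
    by (subst card_Diff_singleton) (auto simp: of_nat_diff Suc_le_eq)
  have split: "(\<Sum>l\<in>UNIV. h l) = h i0 + (\<Sum>l\<in>?U. h l)" for h :: "'n \<Rightarrow> real"
    by (rule sum.remove) auto
  have row0: "(\<Sum>l\<in>UNIV. F i0 l) = p + (real CARD('n) - 1) * q"
    unfolding split using assms by (simp add: card)
  have row: "(\<Sum>l\<in>UNIV. F k l) = q + (real CARD('n) - 1) * s + 2 * s" if k: "k \<in> ?U" for k
  proof -
    have "(\<Sum>l\<in>?U. F k l) = (\<Sum>l\<in>?U. s + (if l = k then 2 * s else 0))"
      using assms k by (intro sum.cong) auto
    also have "\<dots> = (real CARD('n) - 1) * s + 2 * s"
      using k by (simp add: sum.distrib card)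
    finally show ?thesis unfolding split using assms k by simp
  qed
  have "(\<Sum>k\<in>UNIV. \<Sum>l\<in>UNIV. F k l) =
      p + (real CARD('n) - 1) * q + (\<Sum>k\<in>?U. q + (real CARD('n) - 1) * s + 2 * s)"
    unfolding split[of "\<lambda>k. \<Sum>l\<in>UNIV. F k l"] row0 by (simp add: row)
  also have "\<dots> = p + 2 * (real CARD('n) - 1) * q + ((real CARD('n))\<^sup>2 - 1) * s"
    by (simp add: card power2_eq_square algebra_simps)
  finally show ?thesis .
qed


section \<open>The kurtosis formula\<close>

theorem proposition2:
  fixes M :: "'a measure" and Y :: "'a \<Rightarrow> real ^ 'n"
    and \<mu> \<delta> :: "real ^ 'n" and \<Omega> :: "real ^ 'n ^ 'n" and g :: "real \<Rightarrow> real"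
    and N :: "'b measure" and R :: "'b \<Rightarrow> real"
    and N0 :: "'c measure" and R0 :: "'c \<Rightarrow> real"
    and k a b c d ds :: real
  assumes "prob_space M" and "prob_space N" and "prob_space N0"
    and "skew_elliptical M Y \<mu> \<Omega> \<delta> g"
    and "moments_exist M Y 4"
    and "AE \<omega> in N. 0 \<le> R \<omega>"
    and "distributed N lborel R (\<lambda>r. ennreal (radial_density CARD('n) g r))"
    and "chi_distributed N0 R0 (CARD('n) + 1)"
    and "k = real CARD('n)"
    and "ds = delta_star \<Omega> \<delta>"
    and "a = (\<integral>\<omega>. R \<omega> \<partial>N) / (\<integral>\<omega>. R0 \<omega> \<partial>N0) * sqrt (2 / pi)"
    and "b = (\<integral>\<omega>. (R \<omega>) ^ 2 \<partial>N) / (\<integral>\<omega>. (R0 \<omega>) ^ 2 \<partial>N0)"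
    and "c = (\<integral>\<omega>. (R \<omega>) ^ 3 \<partial>N) / (\<integral>\<omega>. (R0 \<omega>) ^ 3 \<partial>N0) * sqrt (2 / pi)"
    and "d = (\<integral>\<omega>. (R \<omega>) ^ 4 \<partial>N) / (\<integral>\<omega>. (R0 \<omega>) ^ 4 \<partial>N0)"
  shows "mardia_kurtosis M Y =
    (3 * d + 6 * a * (a * b - 2 * c) * ds ^ 2 + a * (4 * c - 3 * a ^ 3) * ds ^ 4)
        / (b - a ^ 2 * ds ^ 2) ^ 2
    + (k ^ 2 - 1) * d / b ^ 2
    + 2 * (k - 1) * (d + a * (a * b - 2 * c) * ds ^ 2) / (b * (b - a ^ 2 * ds ^ 2))"
proof -
  interpret prob_space M by fact
  have se: "skew_elliptical M Y \<mu> \<Omega> \<delta> g" by fact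
  have sym: "transpose \<Omega> = \<Omega>" and pd: "positive_definite \<Omega>"
    and lt1: "\<delta> \<bullet> (matrix_inv \<Omega> *v \<delta>) < 1"
    and sph: "spherical_density_generator TYPE((real ^ 'n) \<times> real) g"
    using se unfolding skew_elliptical_def by auto
  \<comment> \<open>Any coordinate can serve as the skewed one.\<close>
  define i0 :: 'n where "i0 = undefined"
  obtain A where A: "transpose A ** matrix_inv \<Omega> ** A = mat 1"
      "A ** (transpose A ** matrix_inv \<Omega>) = mat 1" "A *v axis i0 (delta_star \<Omega> \<delta>) = \<delta>"
    using canonical_factor[OF sym pd, of i0 \<delta>] by blast
  define B where "B = transpose A ** matrix_inv \<Omega>"
  define V where "V \<omega> = B *v (Y \<omega> - \<mu>)" for \<omega>
  define G where "G t = g \<bar>t\<bar>" for t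
  define l where "l = ds / sqrt (1 - ds\<^sup>2)"
  have Gm: "G \<in> borel_measurable borel"
    unfolding G_def[abs_def] by (rule spherical_generator_abs_measurable[OF sph])
  have G0: "0 \<le> G t" for t using sph unfolding G_def spherical_density_generator_def by auto
  have mass: "(\<integral>\<^sup>+z. ennreal (G (z \<bullet> z)) \<partial>(lborel :: ((real^'n) \<times> real) measure)) = 1"
    using sph unfolding G_def spherical_density_generator_def by simp
  have RG: "distributed N lborel R (\<lambda>r. ennreal (radial_density CARD('n) G r))"
    using assms(7) by (simp add: radial_density_def G_def cong: if_cong)
  define J where "J m = radial_integral (CARD('n) + 1 + m) (\<lambda>t. ennreal (G t))" for m
  define \<Gamma> where "\<Gamma> m = radial_integral (CARD('n) + 1 + m)
    (\<lambda>t. ennreal (gaussian_generator (CARD('n) + 1) t))" for m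
  define \<rho> where "\<rho> m = enn2real (J m) / enn2real (\<Gamma> m)" for m
  have \<rho>: "\<rho> m = (\<integral>\<omega>. R \<omega> ^ m \<partial>N) / (\<integral>\<omega>. R0 \<omega> ^ m \<partial>N0)" for m
    unfolding \<rho>_def J_def \<Gamma>_def
    by (rule moment_ratio[OF assms(2,3,6) RG assms(8) Gm G0 mass])
  have a: "a = \<rho> 1 * sqrt (2 / pi)" and b: "b = \<rho> 2" and c: "c = \<rho> 3 * sqrt (2 / pi)" and d: "d = \<rho> 4"
    using assms by (simp_all add: \<rho>)
  have J0: "J 0 = \<Gamma> 0" unfolding J_def \<Gamma>_def
    using radial_integral_spherical_eq_gaussian[OF Gm mass] by simp
  have \<Gamma>fin: "\<Gamma> m < \<infinity>" and \<Gamma>pos: "0 < \<Gamma> m" for m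
    using radial_integral_gaussian_finite[of "CARD('n) + m" "CARD('n) + 1"] radial_integral_gaussian_pos
    unfolding \<Gamma>_def by auto
  have J4: "J 4 < \<infinity>"
    unfolding J_def G_def by (rule fourth_radial_moment_finite[OF assms(1) se A assms(5)])
  have J: "J m < \<infinity>" if "m \<le> 4" for m
    using radial_integral_finite_mono[of "CARD('n) + 1" "CARD('n) + 1 + m" "CARD('n) + 1 + 4" "\<lambda>t. ennreal (G t)"]
      that J4 J0 \<Gamma>fin[of 0] Gm unfolding J_def by simp

  have ds2: "ds\<^sup>2 < 1" "0 \<le> ds"
  proof -
    have "0 \<le> \<delta> \<bullet> (matrix_inv \<Omega> *v \<delta>)"
      using matrix_inv_symmetric_positive_definite(4)[OF sym pd] unfolding positive_definite_def
      by (cases "\<delta> = 0") (auto simp: less_imp_le)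
    then show "ds\<^sup>2 < 1" "0 \<le> ds" using lt1 by (simp_all add: assms(10) delta_star_def)
  qed
  have l0: "0 \<le> l" unfolding l_def using ds2 by simp
  have l_ds: "l / sqrt (1 + l\<^sup>2) = ds"
  proof -
    have "1 + l\<^sup>2 = 1 / (1 - ds\<^sup>2)"
      unfolding l_def using ds2 by (simp add: power_divide field_simps)
    then show ?thesis using ds2 unfolding l_def by (simp add: real_sqrt_divide)
  qed

  \<comment> \<open>Vanishing of a radial integral means that \<open>g\<close> vanishes almost everywhere, whatever its order.\<close>
  have b_pos: "0 < b"
  proof -
    have "J 2 \<noteq> 0"
    proof
      assume "J 2 = 0"
      then have "J 0 = 0" unfolding J_def using Gm by (simp add: radial_integral_0_iff)
      then show False using J0 \<Gamma>pos[of 0] by simp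
    qed
    then show ?thesis
      unfolding b \<rho>_def using J[of 2] \<Gamma>fin[of 2] \<Gamma>pos[of 2]
      by (simp add: enn2real_positive_iff zero_less_iff_neq_zero)
  qed
  \<comment> \<open>Together with \<open>\<delta>\<^sub>*\<^sup>2 < 1\<close> this makes the variance of the skewed coordinate positive.\<close>
  have "a\<^sup>2 \<le> b"
    unfolding a b \<rho>_def J_def \<Gamma>_def
    by (rule spherical_abs_moment_squared_le[OF Gm G0 mass]) (use J[of 1] J[of 2] in \<open>simp_all add: J_def\<close>)
  then have "a\<^sup>2 * ds\<^sup>2 \<le> b * ds\<^sup>2" by (intro mult_right_mono) auto
  also have "\<dots> < b" using b_pos ds2 by simp
  finally have v_pos: "0 < b - a\<^sup>2 * ds\<^sup>2" by simp

  define mom where "mom i p = skew_normal_moment (if i = i0 then l else 0) p" for i and p :: nat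
  have mom0: "mom i 0 = 1" and mom2: "mom i 2 = 1" and mom4: "mom i 4 = 3" for i
    by (simp_all add: mom_def skew_normal_moment_0 skew_normal_moment_2 skew_normal_moment_4)
  have mom1: "mom i 1 = (if i = i0 then sqrt (2 / pi) * ds else 0)" for i
    unfolding mom_def using skew_normal_moment_1[OF l0] skew_normal_moment_1[of 0] by (simp add: l_ds)
  note mom1_Suc = mom1[unfolded One_nat_def]
  have mom3: "mom i0 3 = sqrt (2 / pi) * ds * (3 - ds\<^sup>2)"
    unfolding mom_def using skew_normal_moment_3[OF l0] by (simp only: l_ds if_True refl)
  have expect: "integrable M (\<lambda>\<omega>. vec_monomial e (V \<omega>)) \<and>
      (\<integral>\<omega>. vec_monomial e (V \<omega>) \<partial>M) = \<rho> (\<Sum>i\<in>UNIV. e i) * (\<Prod>i\<in>UNIV. mom i (e i))"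
    if "(\<Sum>i\<in>UNIV. e i) \<le> 4" for e
    using skew_elliptical_canonical_expectation[OF assms(1) se A, of e] J[OF that]
    unfolding J_def \<Gamma>_def \<rho>_def mom_def l_def V_def B_def G_def assms(10) by simp
  have single: "integrable M (\<lambda>\<omega>. V \<omega> $ i ^ p) \<and> (\<integral>\<omega>. V \<omega> $ i ^ p \<partial>M) = \<rho> p * mom i p"
    if "p \<le> 4" for i p
    using expect[of "(\<lambda>_. 0)(i := p)"] that unfolding sum_single vec_monomial_single mom_def prod_single_moment
    by simp
  have pair: "integrable M (\<lambda>\<omega>. V \<omega> $ i ^ p * V \<omega> $ j ^ q) \<and>
      (\<integral>\<omega>. V \<omega> $ i ^ p * V \<omega> $ j ^ q \<partial>M) = \<rho> (p + q) * (mom i p * mom j q)"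
    if "i \<noteq> j" "p + q \<le> 4" for i j p q
    using expect[of "(\<lambda>_. 0)(i := p, j := q)"] that
    unfolding sum_pair[OF that(1)] vec_monomial_pair[OF that(1)] prod_pair[OF that(1), of mom, OF mom0]
    by simp
  define m where "m = a * ds"
  define \<xi> where "\<xi> = axis i0 m"
  have \<xi>: "\<xi> $ i = (if i = i0 then m else 0)" for i by (simp add: \<xi>_def axis_def)
  have int1: "integrable M (\<lambda>\<omega>. V \<omega> $ i)" and E1: "(\<integral>\<omega>. V \<omega> $ i \<partial>M) = \<xi> $ i" for i
    using single[of 1 i] by (auto simp: mom1_Suc \<xi> m_def a)
  have E2: "integrable M (\<lambda>\<omega>. (V \<omega> $ i)\<^sup>2)" "(\<integral>\<omega>. (V \<omega> $ i)\<^sup>2 \<partial>M) = b" for i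
    using single[of 2 i] by (auto simp: mom2 b)
  have E3: "integrable M (\<lambda>\<omega>. V \<omega> $ i0 ^ 3)" "(\<integral>\<omega>. V \<omega> $ i0 ^ 3 \<partial>M) = c * ds * (3 - ds\<^sup>2)"
    using single[of 3 i0] by (auto simp: mom3 c)
  have E4: "integrable M (\<lambda>\<omega>. V \<omega> $ i ^ 4)" "(\<integral>\<omega>. V \<omega> $ i ^ 4 \<partial>M) = 3 * d" for i
    using single[of 4 i] by (auto simp: mom4 d)
  have E11: "integrable M (\<lambda>\<omega>. V \<omega> $ i * V \<omega> $ j)" "(\<integral>\<omega>. V \<omega> $ i * V \<omega> $ j \<partial>M) = 0" if "i \<noteq> j" for i j
    using pair[OF that, of 1 1] that by (auto simp: mom1_Suc)
  have E12: "integrable M (\<lambda>\<omega>. V \<omega> $ i0 * (V \<omega> $ j)\<^sup>2)" "(\<integral>\<omega>. V \<omega> $ i0 * (V \<omega> $ j)\<^sup>2 \<partial>M) = c * ds" if "j \<noteq> i0" for j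
    using pair[OF that[symmetric], of 1 2] by (auto simp: mom1_Suc mom2 c numeral_3_eq_3)
  have E22: "integrable M (\<lambda>\<omega>. (V \<omega> $ i)\<^sup>2 * (V \<omega> $ j)\<^sup>2)" "(\<integral>\<omega>. (V \<omega> $ i)\<^sup>2 * (V \<omega> $ j)\<^sup>2 \<partial>M) = d" if "i \<noteq> j" for i j
    using pair[OF that, of 2 2] mom2 by (auto simp: d)
  note [simp] = int1 E1 E2 E3 E4

  define X where "X i \<omega> = V \<omega> $ i - \<xi> $ i" for i \<omega>
  define v where "v i = (if i = i0 then b - a\<^sup>2 * ds\<^sup>2 else b)" for i
  have cov: "integrable M (\<lambda>\<omega>. X i \<omega> * X j \<omega>) \<and> (\<integral>\<omega>. X i \<omega> * X j \<omega> \<partial>M) = (if i = j then v i else 0)" for i j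
  proof -
    have e: "X i \<omega> * X j \<omega> = V \<omega> $ i * V \<omega> $ j - \<xi> $ j * V \<omega> $ i - \<xi> $ i * V \<omega> $ j + \<xi> $ i * \<xi> $ j" for \<omega>
      by (simp add: X_def algebra_simps)
    have "integrable M (\<lambda>\<omega>. V \<omega> $ i * V \<omega> $ j) \<and> (\<integral>\<omega>. V \<omega> $ i * V \<omega> $ j \<partial>M) = (if i = j then b else 0)"
      using E2[of i] E11[of i j] by (cases "i = j") (auto simp: power2_eq_square)
    then show ?thesis
      unfolding e by (auto simp: prob_space \<xi> v_def m_def power2_eq_square)
  qed
  have P: "integrable M (\<lambda>\<omega>. X i0 \<omega> ^ 4)"
    "(\<integral>\<omega>. X i0 \<omega> ^ 4 \<partial>M) = 3 * d + 6 * a * (a * b - 2 * c) * ds ^ 2 + a * (4 * c - 3 * a ^ 3) * ds ^ 4"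
  proof -
    have e: "X i0 \<omega> ^ 4 = V \<omega> $ i0 ^ 4 - 4 * m * V \<omega> $ i0 ^ 3 + 6 * m\<^sup>2 * (V \<omega> $ i0)\<^sup>2 - 4 * m ^ 3 * V \<omega> $ i0 + m ^ 4" for \<omega>
      by (simp add: X_def \<xi> power4_eq_xxxx power3_eq_cube power2_eq_square algebra_simps)
    show "integrable M (\<lambda>\<omega>. X i0 \<omega> ^ 4)" unfolding e by simp
    have "(\<integral>\<omega>. X i0 \<omega> ^ 4 \<partial>M) = 3 * d - 4 * m * (c * ds * (3 - ds\<^sup>2)) + 6 * m\<^sup>2 * b - 4 * m ^ 3 * m + m ^ 4"
      unfolding e by (simp add: prob_space \<xi>)
    also have "\<dots> = 3 * d + 6 * a * (a * b - 2 * c) * ds ^ 2 + a * (4 * c - 3 * a ^ 3) * ds ^ 4"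
      unfolding m_def by (simp add: power4_eq_xxxx power3_eq_cube power2_eq_square algebra_simps)
    finally show "(\<integral>\<omega>. X i0 \<omega> ^ 4 \<partial>M) = \<dots>" .
  qed
  have Q: "integrable M (\<lambda>\<omega>. (X i0 \<omega>)\<^sup>2 * (X j \<omega>)\<^sup>2)"
    "(\<integral>\<omega>. (X i0 \<omega>)\<^sup>2 * (X j \<omega>)\<^sup>2 \<partial>M) = d + a * (a * b - 2 * c) * ds ^ 2" if "j \<noteq> i0" for j
  proof -
    note [simp] = E12[OF that] E22[OF that[symmetric]]
    have e: "(X i0 \<omega>)\<^sup>2 * (X j \<omega>)\<^sup>2 = (V \<omega> $ i0)\<^sup>2 * (V \<omega> $ j)\<^sup>2 - 2 * m * (V \<omega> $ i0 * (V \<omega> $ j)\<^sup>2)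
        + m\<^sup>2 * (V \<omega> $ j)\<^sup>2" for \<omega>
      using that by (simp add: X_def \<xi> power2_eq_square algebra_simps)
    show "integrable M (\<lambda>\<omega>. (X i0 \<omega>)\<^sup>2 * (X j \<omega>)\<^sup>2)" unfolding e by simp
    have "(\<integral>\<omega>. (X i0 \<omega>)\<^sup>2 * (X j \<omega>)\<^sup>2 \<partial>M) = d - 2 * m * (c * ds) + m\<^sup>2 * b"
      unfolding e by simp
    then show "(\<integral>\<omega>. (X i0 \<omega>)\<^sup>2 * (X j \<omega>)\<^sup>2 \<partial>M) = d + a * (a * b - 2 * c) * ds ^ 2"
      unfolding m_def by (simp add: power2_eq_square algebra_simps)
  qed
  have X_V: "X j \<omega> = V \<omega> $ j" if "j \<noteq> i0" for j \<omega> using that by (simp add: X_def \<xi>)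
  define H where "H i j = (\<integral>\<omega>. (X i \<omega>)\<^sup>2 * (X j \<omega>)\<^sup>2 \<partial>M)" for i j
  have X4: "(X i \<omega>)\<^sup>2 * (X i \<omega>)\<^sup>2 = X i \<omega> ^ 4" for i \<omega>
    by (simp add: power2_eq_square power4_eq_xxxx)
  have intH: "integrable M (\<lambda>\<omega>. (X i \<omega>)\<^sup>2 * (X j \<omega>)\<^sup>2)" for i j
  proof (cases "i = j")
    case True
    then show ?thesis using P E4 by (cases "j = i0") (auto simp: X4 X_V)
  next
    case False
    then consider "i = i0" "j \<noteq> i0" | "j = i0" "i \<noteq> i0" | "i \<noteq> i0" "j \<noteq> i0" by blast
    then show ?thesis
      using Q(1)[of j] Q(1)[of i] E22[OF False] by cases (auto simp: X_V mult.commute)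
  qed
  have "mardia_kurtosis M Y = (\<integral>\<omega>. (\<Sum>i\<in>UNIV. (V \<omega> $ i - \<xi> $ i)\<^sup>2 / v i)\<^sup>2 \<partial>M)"
  proof (rule mardia_kurtosis_affine_diagonal[OF assms(1), where B = B])
    show "Y \<omega> = \<mu> + A *v V \<omega>" for \<omega>
      using A(2) by (simp add: V_def B_def matrix_vector_mul_assoc)
    show "A ** B = mat 1" using A(2) by (simp add: B_def)
    show "v i \<noteq> 0" for i using b_pos v_pos by (simp add: v_def)
  qed (use cov in \<open>auto simp: X_def\<close>)
  also have "\<dots> = (\<integral>\<omega>. (\<Sum>i\<in>UNIV. \<Sum>j\<in>UNIV. (X i \<omega>)\<^sup>2 * (X j \<omega>)\<^sup>2 / (v i * v j)) \<partial>M)"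
    unfolding X_def[symmetric] by (simp add: power2_eq_square[of "sum _ _"] sum_product)
  also have "\<dots> = (\<Sum>i\<in>UNIV. \<Sum>j\<in>UNIV. H i j / (v i * v j))"
    using intH by (simp add: H_def Bochner_Integration.integral_sum Bochner_Integration.integrable_sum)
  also have "\<dots> =
      (3 * d + 6 * a * (a * b - 2 * c) * ds ^ 2 + a * (4 * c - 3 * a ^ 3) * ds ^ 4) / (b - a ^ 2 * ds ^ 2) ^ 2
      + 2 * (real CARD('n) - 1) * ((d + a * (a * b - 2 * c) * ds ^ 2) / (b * (b - a ^ 2 * ds ^ 2)))
      + ((real CARD('n))\<^sup>2 - 1) * (d / b\<^sup>2)"
  proof (rule double_sum_distinguished)
    show "H i0 i0 / (v i0 * v i0) = (3 * d + 6 * a * (a * b - 2 * c) * ds ^ 2 + a * (4 * c - 3 * a ^ 3) * ds ^ 4) /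
        (b - a ^ 2 * ds ^ 2) ^ 2"
      unfolding H_def X4 P(2) v_def by (simp add: power2_eq_square)
    show "H i0 j / (v i0 * v j) = (d + a * (a * b - 2 * c) * ds ^ 2) / (b * (b - a ^ 2 * ds ^ 2))"
      "H j i0 / (v j * v i0) = (d + a * (a * b - 2 * c) * ds ^ 2) / (b * (b - a ^ 2 * ds ^ 2))" if "j \<noteq> i0" for j
      using Q(2)[OF that] that by (simp_all add: H_def v_def mult.commute)
    show "H j j / (v j * v j) = 3 * (d / b\<^sup>2)" if "j \<noteq> i0" for j
    proof -
      have "H j j = 3 * d" unfolding H_def unfolding X4 unfolding X_V[OF that] by (rule E4)
      then show ?thesis using that by (simp add: v_def power2_eq_square)
    qed
    show "H i j / (v i * v j) = d / b\<^sup>2" if "i \<noteq> i0" "j \<noteq> i0" "i \<noteq> j" for i j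
    proof -
      have "H i j = d" unfolding H_def X_V[OF that(1)] X_V[OF that(2)] by (rule E22[OF that(3)])
      then show ?thesis using that by (simp add: v_def power2_eq_square)
    qed
  qed
  finally show ?thesis by (simp add: assms(9))
qed

end
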